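(* Up to inner automorphism, the $3$-dimensional solvable subalgebras of $A_2$ are classified by the following list, where in the two parametrized families $\alpha\in\mathbb{C}$, $\alpha\neq\pm1$: $$\begin{array}{lll} L_2^1 &=& \langle x_1, x_3, 2h_1+h_2\rangle,\\ L_2^2 &=& \langle x_1, y_2, h_1-h_2\rangle,\\ L_{3,-\frac14}^1 &=& \langle x_1, x_3, 2h_1+h_2+x_2\rangle,\\ L_{3,-\frac14}^2 &=& \langle y_1, y_3, 2h_1+h_2+x_2\rangle,\\ L_{3,-\frac29}^1 &=& \langle x_1+x_2, x_3, h_1+h_2\rangle,\\ L_{3,0}^1 &=& \langle x_1, h_1, h_2\rangle,\\ L^{1,\alpha}_{3,-\frac{(2\alpha-1)(\alpha-2)}{9(\alpha-1)^2}} &=& \langle x_1, x_3, (\alpha-1)h_1+\alpha h_2\rangle,\\ L^{2,\alpha}_{3,-\frac{(2\alpha-1)(\alpha-2)}{9(\alpha-1)^2}} &=& \langle x_1, y_2, h_1+\alpha h_2\rangle,\\ L_4^1 &=& \langle x_1, x_3, h_2\rangle,\\ L_4^2 &=& \langle x_1, y_2, h_1+h_2\rangle,\\ L_5^1 &=& \langle x_1, x_2, x_3\rangle. \end{array}$$ The subscript of each listed subalgebra gives its isomorphism type among the Lie algebras $L_2$, $L_{3,a}$, $L_4$, $L_5$ (e.g. $L^{i,\alpha}_{3,a}\cong L_{3,a}$). Every $3$-dimensional solvable subalgebra of $A_2$ is equivalent to one on the list, and the listed subalgebras are pairwise inequivalent, except that, for each $i\in\{1,2\}$ and $\alpha,\beta\in\mathbb{C}\setminus\{1,-1\}$,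 $L^{i,\alpha}_{3,-\frac{(2\alpha-1)(\alpha-2)}{9(\alpha-1)^2}}$ is equivalent to $L^{i,\beta}_{3,-\frac{(2\beta-1)(\beta-2)}{9(\beta-1)^2}}$ if and only if $\alpha=\beta$ or $\alpha\beta=1$.
   Context: $A_2$ is the Lie algebra of traceless $3\times3$ complex matrices. Its Chevalley basis $x_i,y_i$ ($1\le i\le 3$), $h_1,h_2$ is defined by $$ah_1+bh_2+cx_1+dx_2+ex_3+c'y_1+d'y_2+e'y_3=\begin{pmatrix} a & c & -e\\ c' & b-a & d\\ -e' & d' & -b\end{pmatrix}.$$ $\langle W_1,\dots,W_m\rangle$ denotes the Lie subalgebra of $A_2$ generated by $W_1,\dots,W_m$. Two subalgebras are equivalent if an inner automorphism of $A_2$ maps one onto the other, i.e. if they are conjugate by an element of $\mathrm{SL}(3,\mathbb{C})$. The following are complex Lie algebras with basis $z_1,z_2,z_3$ and the indicated nonzero brackets (up to antisymmetry): $L_2$: $[z_3,z_1]=z_1$, $[z_3,z_2]=z_2$; $L_{3,a}$ ($a\in\mathbb{C}$): $[z_3,z_1]=z_2$, $[z_3,z_2]=az_1+z_2$; $L_4$: $[z_3,z_1]=z_2$, $[z_3,z_2]=z_1$; $L_5$: $[z_3,z_1]=z_2$. *)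

theory Defs
  imports "HOL-Analysis.Analysis"
begin

type_synonym cmat3 = "complex^3^3"

text \<open>
  \<open>*\<^sub>R\<close> on matrices is real scaling, and \<open>*s\<close> on \<open>complex^3^3\<close> would scale by a row vector,
  so the complex vector space structure has to be set up here.
\<close>

definition cscale :: "complex \<Rightarrow> cmat3 \<Rightarrow> cmat3" where
  "cscale c A = (\<chi> i j. c * A $ i $ j)"

interpretation cmat: vector_space cscale
  by unfold_locales (simp_all add: cscale_def vec_eq_iff algebra_simps)

definition lie_br :: "cmat3 \<Rightarrow> cmat3 \<Rightarrow> cmat3" where
  "lie_br A B = A ** B - B ** A"

definition A2 :: "cmat3 set" where
  "A2 = {A. trace A = 0}"

definition lie_subalgebra :: "cmat3 set \<Rightarrow> bool" where
  "lie_subalgebra S \<longleftrightarrow> S \<subseteq> A2 \<and> cmat.subspace S \<and> (\<forall>A\<in>S. \<forall>B\<in>S. lie_br A B \<in> S)"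

definition generated :: "cmat3 set \<Rightarrow> cmat3 set" where
  "generated W = lie_subalgebra hull W"

primrec derived_series :: "cmat3 set \<Rightarrow> nat \<Rightarrow> cmat3 set" where
  "derived_series S 0 = S"
| "derived_series S (Suc n) =
     cmat.span {lie_br A B | A B. A \<in> derived_series S n \<and> B \<in> derived_series S n}"

definition solvable :: "cmat3 set \<Rightarrow> bool" where
  "solvable S \<longleftrightarrow> (\<exists>n. derived_series S n = {0})"

definition equivalent :: "cmat3 set \<Rightarrow> cmat3 set \<Rightarrow> bool" where
  "equivalent S T \<longleftrightarrow> (\<exists>P :: cmat3. det P = 1 \<and> (\<lambda>A. P ** A ** matrix_inv P) ` S = T)"


definition chevalley ::
  "complex \<Rightarrow> complex \<Rightarrow> complex \<Rightarrow> complex \<Rightarrow> complex \<Rightarrow> complex \<Rightarrow> complex \<Rightarrow> complex \<Rightarrow> cmat3" where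
  "chevalley a b c d e c' d' e' =
     vector [vector [ a,   c,     -e],
             vector [ c',  b - a,  d],
             vector [-e',  d',    -b]]"

definition h1 :: cmat3 where "h1 = chevalley 1 0 0 0 0 0 0 0"
definition h2 :: cmat3 where "h2 = chevalley 0 1 0 0 0 0 0 0"
definition x1 :: cmat3 where "x1 = chevalley 0 0 1 0 0 0 0 0"
definition x2 :: cmat3 where "x2 = chevalley 0 0 0 1 0 0 0 0"
definition x3 :: cmat3 where "x3 = chevalley 0 0 0 0 1 0 0 0"
definition y1 :: cmat3 where "y1 = chevalley 0 0 0 0 0 1 0 0"
definition y2 :: cmat3 where "y2 = chevalley 0 0 0 0 0 0 1 0"
definition y3 :: cmat3 where "y3 = chevalley 0 0 0 0 0 0 0 1"

lemma chevalley_combination: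
  "cscale a h1 + cscale b h2 + cscale c x1 + cscale d x2 + cscale e x3
     + cscale c' y1 + cscale d' y2 + cscale e' y3 = chevalley a b c d e c' d' e'"
  by (simp add: h1_def h2_def x1_def x2_def x3_def y1_def y2_def y3_def
      chevalley_def cscale_def vec_eq_iff forall_3)


datatype lie_type = L2 | L3 complex | L4 | L5

definition z1 :: "complex^3" where "z1 = axis 1 1"
definition z2 :: "complex^3" where "z2 = axis 2 1"
definition z3 :: "complex^3" where "z3 = axis 3 1"

text \<open>
  The bilinear alternating bracket on the span of \<open>z1, z2, z3\<close> with
  \<open>[z3, z1] = p\<close>, \<open>[z3, z2] = q\<close> and \<open>[z1, z2] = 0\<close>.
\<close>

definition z_bracket :: "complex^3 \<Rightarrow> complex^3 \<Rightarrow> complex^3 \<Rightarrow> complex^3 \<Rightarrow> complex^3" where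
  "z_bracket p q u v = (u$3 * v$1 - u$1 * v$3) *s p + (u$3 * v$2 - u$2 * v$3) *s q"

primrec bracket :: "lie_type \<Rightarrow> complex^3 \<Rightarrow> complex^3 \<Rightarrow> complex^3" where
  "bracket L2 = z_bracket z1 z2"
| "bracket (L3 a) = z_bracket z2 (a *s z1 + z2)"
| "bracket L4 = z_bracket z2 z1"
| "bracket L5 = z_bracket z2 0"

definition has_type :: "cmat3 set \<Rightarrow> lie_type \<Rightarrow> bool" where
  "has_type S t \<longleftrightarrow> (\<exists>\<phi> :: complex^3 \<Rightarrow> cmat3.
     Vector_Spaces.linear (*s) cscale \<phi> \<and> bij_betw \<phi> UNIV S \<and>
     (\<forall>u v. \<phi> (bracket t u v) = lie_br (\<phi> u) (\<phi> v)))"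


text \<open>
  One label per entry of the list; the superscript is the last digit of the name.
  The parameters of the two families are restricted by \<open>admissible\<close>.
\<close>

datatype label =
    L2_1 | L2_2 | L3_quarter_1 | L3_quarter_2 | L3_two_ninths_1 | L3_zero_1
  | L3_family_1 complex | L3_family_2 complex | L4_1 | L4_2 | L5_1

primrec admissible :: "label \<Rightarrow> bool" where
  "admissible L2_1 = True"
| "admissible L2_2 = True"
| "admissible L3_quarter_1 = True"
| "admissible L3_quarter_2 = True"
| "admissible L3_two_ninths_1 = True"
| "admissible L3_zero_1 = True"
| "admissible (L3_family_1 \<alpha>) = (\<alpha> \<noteq> 1 \<and> \<alpha> \<noteq> -1)"
| "admissible (L3_family_2 \<alpha>) = (\<alpha> \<noteq> 1 \<and> \<alpha> \<noteq> -1)"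
| "admissible L4_1 = True"
| "admissible L4_2 = True"
| "admissible L5_1 = True"

primrec listed :: "label \<Rightarrow> cmat3 set" where
  "listed L2_1 = generated {x1, x3, cscale 2 h1 + h2}"
| "listed L2_2 = generated {x1, y2, h1 - h2}"
| "listed L3_quarter_1 = generated {x1, x3, cscale 2 h1 + h2 + x2}"
| "listed L3_quarter_2 = generated {y1, y3, cscale 2 h1 + h2 + x2}"
| "listed L3_two_ninths_1 = generated {x1 + x2, x3, h1 + h2}"
| "listed L3_zero_1 = generated {x1, h1, h2}"
| "listed (L3_family_1 \<alpha>) = generated {x1, x3, cscale (\<alpha> - 1) h1 + cscale \<alpha> h2}"
| "listed (L3_family_2 \<alpha>) = generated {x1, y2, h1 + cscale \<alpha> h2}"
| "listed L4_1 = generated {x1, x3, h2}"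
| "listed L4_2 = generated {x1, y2, h1 + h2}"
| "listed L5_1 = generated {x1, x2, x3}"

primrec subscript :: "label \<Rightarrow> lie_type" where
  "subscript L2_1 = L2"
| "subscript L2_2 = L2"
| "subscript L3_quarter_1 = L3 (- (1 / 4))"
| "subscript L3_quarter_2 = L3 (- (1 / 4))"
| "subscript L3_two_ninths_1 = L3 (- (2 / 9))"
| "subscript L3_zero_1 = L3 0"
| "subscript (L3_family_1 \<alpha>) = L3 (- ((2 * \<alpha> - 1) * (\<alpha> - 2) / (9 * (\<alpha> - 1)\<^sup>2)))"
| "subscript (L3_family_2 \<alpha>) = L3 (- ((2 * \<alpha> - 1) * (\<alpha> - 2) / (9 * (\<alpha> - 1)\<^sup>2)))"
| "subscript L4_1 = L4"
| "subscript L4_2 = L4"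
| "subscript L5_1 = L5"

end

theory Submission
  imports Defs "HOL-Computational_Algebra.Fundamental_Theorem_Algebra"
begin

text \<open>
  By Lie's theorem a solvable subalgebra can be made upper triangular; in dimension three this is
  obtained from a chain of ideals \<open>\<langle>C\<rangle> \<subseteq> \<langle>C, B\<rangle> \<subseteq> \<langle>C, B, T\<rangle>\<close>, applied to the subalgebra and
  its transpose to find an invariant flag. For triangular \<open>S\<close> one looks at the space of diagonals
  of its elements. If it is two-dimensional, \<open>S\<close> contains the diagonal torus up to conjugation and
  one root vector. If it is zero, \<open>S\<close> consists of all strictly upper triangular matrices. If it is a
  line, then \<open>S\<close> is spanned by \<open>E\<^sub>1\<^sub>3\<close>, some \<open>a E\<^sub>1\<^sub>2 + b E\<^sub>2\<^sub>3\<close> and a matrix \<open>T\<close>, and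
  conjugation brings \<open>T\<close> to normal form.

  Inequivalent entries are separated by the isomorphism type, which is determined by the forms
  \<open>tr (ad u)\<close> and \<open>tr ((ad u)\<^sup>2)\<close> up to scaling (only \<open>L2\<close> and \<open>L3 (- 1 / 4)\<close> need an extra argument),
  and by whether all nilpotent elements are of the form \<open>u v\<^sup>T\<close> with a common \<open>u\<close> or a common \<open>v\<close>.
\<close>

section \<open>Explicit matrices\<close>

text \<open>Conjugations are only ever computed on the three generators of a listed entry: if their
  images lie in \<open>S\<close>, the two subalgebras agree because both have dimension 3. Elements
  of \<open>S\<close> with prescribed zeros come from one count: two linear functionals on a
  3-dimensional space share a nonzero zero.

  The excluded parameters are degenerate members of the families. In the first family the torus
  generator is diag(\<alpha> - 1, 1, -\<alpha>), acting on \<open>x1\<close> and \<open>x3\<close>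
  with eigenvalues \<alpha> - 2 and 2\<alpha> - 1. They coincide for \<alpha> = -1, which gives
  \<open>L2_1\<close>, and sum to 0 for \<alpha> = 1, which gives \<open>L4_1\<close>; the second
  family behaves alike up to sign. The isomorphism type sees the eigenvalues only as an unordered
  pair up to scaling, which leaves exactly the ambiguity between \<alpha> and 1/\<alpha>, and
  exchanging two coordinates realizes it by conjugation. Both families carry the same types, so only
  the shape of their nilpotent elements tells them apart.\<close>

definition m3 :: "complex \<Rightarrow> complex \<Rightarrow> complex \<Rightarrow> complex \<Rightarrow> complex \<Rightarrow> complex \<Rightarrow>
    complex \<Rightarrow> complex \<Rightarrow> complex \<Rightarrow> cmat3" where
  "m3 a b c d e f g h i = vector [vector [a, b, c], vector [d, e, f], vector [g, h, i]]"

lemma m3_nth [simp]: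
  "m3 a b c d e f g h i $ 1 $ 1 = a" "m3 a b c d e f g h i $ 1 $ 2 = b" "m3 a b c d e f g h i $ 1 $ 3 = c"
  "m3 a b c d e f g h i $ 2 $ 1 = d" "m3 a b c d e f g h i $ 2 $ 2 = e" "m3 a b c d e f g h i $ 2 $ 3 = f"
  "m3 a b c d e f g h i $ 3 $ 1 = g" "m3 a b c d e f g h i $ 3 $ 2 = h" "m3 a b c d e f g h i $ 3 $ 3 = i"
  by (simp_all add: m3_def)

lemma m3_eta: "A = m3 (A$1$1) (A$1$2) (A$1$3) (A$2$1) (A$2$2) (A$2$3) (A$3$1) (A$3$2) (A$3$3)"
  by (simp add: vec_eq_iff forall_3)

text \<open>Replacing a matrix by nine scalars turns matrix identities into polynomial identities
  that \<open>algebra_simps\<close> can settle.\<close>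

lemma m3_cases: obtains a b c d e f g h i where "A = m3 a b c d e f g h i"
  using m3_eta by blast

lemma m3_eq_iff [simp]:
  "m3 a b c d e f g h i = m3 a' b' c' d' e' f' g' h' i' \<longleftrightarrow>
     a = a' \<and> b = b' \<and> c = c' \<and> d = d' \<and> e = e' \<and> f = f' \<and> g = g' \<and> h = h' \<and> i = i'"
  by (auto simp: vec_eq_iff forall_3)

lemma m3_zero: "0 = m3 0 0 0 0 0 0 0 0 0"
  and m3_one: "mat 1 = m3 1 0 0 0 1 0 0 0 1"
  by (simp_all add: vec_eq_iff forall_3 mat_def)

lemma m3_eq_0_iff [simp]:
  "m3 a b c d e f g h i = 0 \<longleftrightarrow>
     a = 0 \<and> b = 0 \<and> c = 0 \<and> d = 0 \<and> e = 0 \<and> f = 0 \<and> g = 0 \<and> h = 0 \<and> i = 0"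
  by (simp add: m3_zero)

lemma m3_add [simp]: "m3 a b c d e f g h i + m3 a' b' c' d' e' f' g' h' i' =
    m3 (a + a') (b + b') (c + c') (d + d') (e + e') (f + f') (g + g') (h + h') (i + i')"
  and m3_diff [simp]: "m3 a b c d e f g h i - m3 a' b' c' d' e' f' g' h' i' =
    m3 (a - a') (b - b') (c - c') (d - d') (e - e') (f - f') (g - g') (h - h') (i - i')"
  and m3_minus [simp]: "- m3 a b c d e f g h i =
    m3 (- a) (- b) (- c) (- d) (- e) (- f) (- g) (- h) (- i)"
  and m3_cscale [simp]: "cscale k (m3 a b c d e f g h i) =
    m3 (k * a) (k * b) (k * c) (k * d) (k * e) (k * f) (k * g) (k * h) (k * i)"
  and m3_transpose [simp]: "transpose (m3 a b c d e f g h i) = m3 a d g b e h c f i"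
  by (simp_all add: vec_eq_iff forall_3 cscale_def transpose_def)

lemma m3_mult [simp]: "m3 a b c d e f g h i ** m3 a' b' c' d' e' f' g' h' i' =
    m3 (a * a' + b * d' + c * g') (a * b' + b * e' + c * h') (a * c' + b * f' + c * i')
       (d * a' + e * d' + f * g') (d * b' + e * e' + f * h') (d * c' + e * f' + f * i')
       (g * a' + h * d' + i * g') (g * b' + h * e' + i * h') (g * c' + h * f' + i * i')"
  by (simp add: vec_eq_iff forall_3 matrix_matrix_mult_def sum_3)

lemma trace_m3 [simp]: "trace (m3 a b c d e f g h i) = a + e + i"
  by (simp add: trace_def sum_3)

lemma det_m3 [simp]: "det (m3 a b c d e f g h i) =
    a * e * i + b * f * g + c * d * h - a * f * h - b * d * i - c * e * g"
  by (simp add: det_3)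

lemma generators_m3:
  "h1 = m3 1 0 0 0 (-1) 0 0 0 0" "h2 = m3 0 0 0 0 1 0 0 0 (-1)"
  "x1 = m3 0 1 0 0 0 0 0 0 0" "x2 = m3 0 0 0 0 0 1 0 0 0" "x3 = m3 0 0 (-1) 0 0 0 0 0 0"
  "y1 = m3 0 0 0 1 0 0 0 0 0" "y2 = m3 0 0 0 0 0 0 0 1 0" "y3 = m3 0 0 0 0 0 0 (-1) 0 0"
  by (simp_all add: h1_def h2_def x1_def x2_def x3_def y1_def y2_def y3_def
      chevalley_def m3_def)

lemma matrix_mul_cscale_left: "cscale k A ** B = cscale k (A ** B)"
  and matrix_mul_cscale_right: "A ** cscale k B = cscale k (A ** B)"
  by (cases A rule: m3_cases; cases B rule: m3_cases; simp add: algebra_simps)+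

lemma matrix_add_rdistrib_cmat: "(A + B) ** C = A ** C + B ** (C :: cmat3)"
  and matrix_diff_ldistrib_cmat: "A ** (B - C) = A ** B - A ** (C :: cmat3)"
  and matrix_diff_rdistrib_cmat: "(A - B) ** C = A ** C - B ** (C :: cmat3)"
  by (cases A rule: m3_cases; cases B rule: m3_cases; cases C rule: m3_cases; simp add: algebra_simps)+

lemma lie_br_add_left: "lie_br (A + B) C = lie_br A C + lie_br B C"
  and lie_br_add_right: "lie_br A (B + C) = lie_br A B + lie_br A C"
  and lie_br_cscale_left: "lie_br (cscale k A) B = cscale k (lie_br A B)"
  and lie_br_cscale_right: "lie_br A (cscale k B) = cscale k (lie_br A B)"
  and lie_br_self: "lie_br A A = 0"
  and lie_br_commute: "lie_br A B = cscale (- 1) (lie_br B A)"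
  by (simp_all add: lie_br_def matrix_add_ldistrib matrix_add_rdistrib_cmat matrix_mul_cscale_left
      matrix_mul_cscale_right cmat.scale_right_diff_distrib)

section \<open>Dimension counts for complex spaces of matrices\<close>

lemma cspan_UNIV: "\<exists>F. finite F \<and> cmat.span F = UNIV"
proof -
  define F where "F = {m3 1 0 0 0 0 0 0 0 0, m3 0 1 0 0 0 0 0 0 0, m3 0 0 1 0 0 0 0 0 0,
    m3 0 0 0 1 0 0 0 0 0, m3 0 0 0 0 1 0 0 0 0, m3 0 0 0 0 0 1 0 0 0,
    m3 0 0 0 0 0 0 1 0 0, m3 0 0 0 0 0 0 0 1 0, m3 0 0 0 0 0 0 0 0 1}"
  have "A \<in> cmat.span F" for A
  proof (cases A rule: m3_cases)
    case (1 a b c d e f g h i)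
    have "cscale a (m3 1 0 0 0 0 0 0 0 0) + (cscale b (m3 0 1 0 0 0 0 0 0 0) +
        (cscale c (m3 0 0 1 0 0 0 0 0 0) + (cscale d (m3 0 0 0 1 0 0 0 0 0) +
        (cscale e (m3 0 0 0 0 1 0 0 0 0) + (cscale f (m3 0 0 0 0 0 1 0 0 0) +
        (cscale g (m3 0 0 0 0 0 0 1 0 0) + (cscale h (m3 0 0 0 0 0 0 0 1 0) +
         cscale i (m3 0 0 0 0 0 0 0 0 1)))))))) \<in> cmat.span F"
      unfolding F_def
      by (intro cmat.span_add cmat.span_scale cmat.span_base) auto
    then show ?thesis by (simp add: 1)
  qed
  moreover have "finite F" by (simp add: F_def)
  ultimately show ?thesis by blast
qed

interpretation cmat_fin: finite_dimensional_vector_space cscale "cmat.extend_basis {}"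
proof
  have ind: "cmat.independent {}" by (rule cmat.independent_empty)
  show "cmat.independent (cmat.extend_basis {})"
    using cmat.independent_extend_basis[OF ind] .
  obtain F where "finite F" "cmat.span F = UNIV" using cspan_UNIV by blast
  then show "finite (cmat.extend_basis {})"
    using cmat.independent_span_bound[OF _ cmat.independent_extend_basis[OF ind]] by auto
  show "cmat.span (cmat.extend_basis {}) = UNIV"
    using cmat.span_extend_basis[OF ind] .
qed

lemma subspace_eq_of_dim_eq:
  assumes "cmat.subspace S" "cmat.subspace T" "S \<subseteq> T" "cmat.dim S = cmat.dim T"
  shows "S = T"
  using assms cmat_fin.subspace_dim_equal[of S T] by simp

lemma span_triple_iff:
  "X \<in> cmat.span {A, B, C} \<longleftrightarrow> (\<exists>a b c. X = cscale a A + cscale b B + cscale c C)"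
proof
  assume "X \<in> cmat.span {A, B, C}"
  then obtain a where "X - cscale a A \<in> cmat.span {B, C}"
    by (auto simp: cmat.span_breakdown_eq)
  then obtain b where "X - cscale a A - cscale b B \<in> cmat.span {C}"
    by (auto simp: cmat.span_breakdown_eq)
  then obtain c where "X - cscale a A - cscale b B - cscale c C \<in> cmat.span {}"
    by (auto simp: cmat.span_breakdown_eq)
  then have "X = cscale a A + cscale b B + cscale c C"
    by (simp add: algebra_simps)
  then show "\<exists>a b c. X = cscale a A + cscale b B + cscale c C" by blast
next
  assume "\<exists>a b c. X = cscale a A + cscale b B + cscale c C"
  then show "X \<in> cmat.span {A, B, C}"
    by (auto intro!: cmat.span_add cmat.span_scale intro: cmat.span_base)
qed

text \<open>If \<open>f T\<close> is nonzero, then \<open>A - (f A / f T) T\<close> lies in the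
  kernel for every \<open>A\<close>, so \<open>T\<close> and the kernel span
  \<open>S\<close>.\<close>

lemma dim_ker_functional:
  assumes S: "cmat.subspace S"
    and add: "\<And>A B. f (A + B) = f A + f B" and scale: "\<And>k A. f (cscale k A) = k * f A"
  shows "cmat.subspace {A \<in> S. f A = (0::complex)}"
    and "cmat.dim S \<le> Suc (cmat.dim {A \<in> S. f A = 0})"
proof -
  have f0: "f 0 = 0" using scale[of 0 0] by simp
  show sub: "cmat.subspace {A \<in> S. f A = 0}"
    using S by (auto simp: cmat.subspace_def add scale f0)
  show "cmat.dim S \<le> Suc (cmat.dim {A \<in> S. f A = 0})"
  proof (cases "\<exists>T\<in>S. f T \<noteq> 0")
    case False
    then have "{A \<in> S. f A = 0} = S" by auto
    then show ?thesis by simp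
  next
    case True
    then obtain T where T: "T \<in> S" "f T \<noteq> 0" by blast
    have "S \<subseteq> cmat.span (insert T {A \<in> S. f A = 0})"
    proof
      fix A assume A: "A \<in> S"
      let ?B = "A + cscale (- (f A / f T)) T"
      have "?B \<in> {A \<in> S. f A = 0}"
        using A T cmat.subspace_add[OF S A cmat.subspace_scale[OF S T(1)]]
        by (simp only: mem_Collect_eq add scale) simp
      then have "?B \<in> cmat.span (insert T {A \<in> S. f A = 0})"
        by (intro cmat.span_base) auto
      moreover have "A = ?B + cscale (f A / f T) T" by simp
      ultimately show "A \<in> cmat.span (insert T {A \<in> S. f A = 0})"
        by (metis (lifting) cmat.span_add cmat.span_base cmat.span_scale insertI1)
    qed
    then have "cmat.dim S \<le> cmat.dim (insert T {A \<in> S. f A = 0})"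
      by (rule cmat_fin.dim_mono)
    also have "\<dots> \<le> Suc (cmat.dim {A \<in> S. f A = 0})"
      by (simp add: cmat_fin.dim_insert)
    finally show ?thesis .
  qed
qed

text \<open>Each functional lowers the dimension by at most one, and 3 - 2 is positive.\<close>

lemma common_zero_of_functionals:
  assumes S: "cmat.subspace S" and dim: "cmat.dim S = 3"
    and f: "\<And>A B. f (A + B) = f A + f B" "\<And>k A. f (cscale k A) = k * f A"
    and g: "\<And>A B. g (A + B) = g A + g B" "\<And>k A. g (cscale k A) = k * g A"
  obtains A where "A \<in> S" "A \<noteq> 0" "f A = (0::complex)" "g A = (0::complex)"
proof -
  let ?K = "{A \<in> S. f A = 0}"
  let ?L = "{A \<in> ?K. g A = 0}"
  have "cmat.dim S \<le> Suc (cmat.dim ?K)" "cmat.dim ?K \<le> Suc (cmat.dim ?L)"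
    using dim_ker_functional[OF S f] dim_ker_functional(2)[OF dim_ker_functional(1)[OF S f] g]
    by blast+
  then have "cmat.dim ?L \<ge> 1" using dim by linarith
  moreover have "cmat.dim ?L = 0" if "?L \<subseteq> {0}"
    using that cmat_fin.dim_eq_0 by blast
  ultimately have "\<not> ?L \<subseteq> {0}" by linarith
  then show ?thesis using that by blast
qed

section \<open>Conjugation\<close>

lemma conj_mult:
  assumes "Q ** P = mat 1"
  shows "P ** A ** Q ** (P ** B ** Q) = P ** (A ** B) ** (Q :: cmat3)"
  by (metis assms matrix_mul_assoc matrix_mul_rid)

lemma conj_lie_br:
  assumes "Q ** P = mat 1"
  shows "P ** lie_br A B ** Q = lie_br (P ** A ** Q) (P ** B ** Q)"
  by (simp add: lie_br_def conj_mult[OF assms] matrix_diff_ldistrib_cmat matrix_diff_rdistrib_cmat)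

lemma conj_add: "P ** (A + B) ** Q = P ** A ** Q + P ** B ** (Q :: cmat3)"
  and conj_cscale: "P ** cscale k A ** Q = cscale k (P ** A ** Q)"
  by (simp_all add: matrix_add_ldistrib matrix_add_rdistrib_cmat matrix_mul_cscale_left
      matrix_mul_cscale_right)

lemma conj_conj:
  assumes "Q ** P = mat 1"
  shows "Q ** (P ** A ** Q) ** P = (A :: cmat3)"
  by (metis assms matrix_mul_assoc matrix_mul_lid matrix_mul_rid)

lemma trace_conj:
  assumes "Q ** P = mat 1"
  shows "trace (P ** A ** Q) = trace (A :: cmat3)"
  by (metis assms matrix_mul_assoc matrix_mul_rid trace_mul_sym)

lemma linear_conj: "Vector_Spaces.linear cscale cscale (\<lambda>A. P ** A ** Q)"
  by unfold_locales (simp_all add: conj_add conj_cscale)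

text \<open>Scalars cancel in a conjugation, so an invertible \<open>P\<close> may be divided by a
  cube root of its determinant. Conjugating matrices can then be chosen freely, permutations of
  determinant -1 included.\<close>

lemma equivalent_iff:
  "equivalent S T \<longleftrightarrow> (\<exists>P Q. P ** Q = mat 1 \<and> Q ** P = mat 1 \<and> (\<lambda>A. P ** A ** Q) ` S = T)"
proof
  assume "equivalent S T"
  then obtain P where P: "det P = 1" "(\<lambda>A. P ** A ** matrix_inv P) ` S = T"
    unfolding equivalent_def by blast
  then have "invertible P" by (simp add: invertible_det_nz)
  then have "\<exists>Q. P ** Q = mat 1 \<and> Q ** P = mat 1" by (simp add: invertible_def)
  then have "P ** matrix_inv P = mat 1 \<and> matrix_inv P ** P = mat 1"
    unfolding matrix_inv_def by (rule someI_ex)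
  with P show "\<exists>P Q. P ** Q = mat 1 \<and> Q ** P = mat 1 \<and> (\<lambda>A. P ** A ** Q) ` S = T" by blast
next
  assume "\<exists>P Q. P ** Q = mat 1 \<and> Q ** P = mat 1 \<and> (\<lambda>A. P ** A ** Q) ` S = T"
  then obtain P Q where PQ: "P ** Q = mat 1" "Q ** P = mat 1" and T: "(\<lambda>A. P ** A ** Q) ` S = T"
    by blast
  have "det P \<noteq> 0" using PQ invertible_det_nz invertible_def by blast
  then obtain k where k: "k \<noteq> 0" "det P = k ^ 3"
    using exists_complex_root_nonzero[of "det P" 3] by auto
  let ?P = "cscale (1 / k) P" and ?Q = "cscale k Q"
  have inv: "?P ** ?Q = mat 1" "?Q ** ?P = mat 1"
    using k PQ by (simp_all add: matrix_mul_cscale_left matrix_mul_cscale_right)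
  then have "\<exists>Q'. ?P ** Q' = mat 1 \<and> Q' ** ?P = mat 1" by blast
  then have "?P ** matrix_inv ?P = mat 1 \<and> matrix_inv ?P ** ?P = mat 1"
    unfolding matrix_inv_def by (rule someI_ex)
  then have "matrix_inv ?P = ?Q"
    by (metis inv matrix_mul_assoc matrix_mul_lid matrix_mul_rid)
  moreover have "det ?P = (1 / k) ^ 3 * det P"
    by (cases P rule: m3_cases) (simp add: algebra_simps power3_eq_cube)
  then have "det ?P = 1" using k by (simp add: power_divide)
  moreover have "?P ** A ** ?Q = P ** A ** Q" for A
    using k by (simp add: matrix_mul_cscale_left matrix_mul_cscale_right)
  ultimately show "equivalent S T"
    unfolding equivalent_def using T by (intro exI[of _ ?P]) simp
qed

lemma equivalent_refl: "equivalent S S"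
  unfolding equivalent_iff by (intro exI[of _ "mat 1"]) simp

lemma equivalent_sym:
  assumes "equivalent S T" shows "equivalent T S"
proof -
  obtain P Q where PQ: "P ** Q = mat 1" "Q ** P = mat 1" and T: "(\<lambda>A. P ** A ** Q) ` S = T"
    using assms unfolding equivalent_iff by blast
  have "(\<lambda>A. Q ** A ** P) ` T = S"
    unfolding T[symmetric] image_image by (simp add: conj_conj[OF PQ(2)])
  with PQ show ?thesis unfolding equivalent_iff by blast
qed

lemma equivalent_trans:
  assumes "equivalent S T" "equivalent T U" shows "equivalent S U"
proof -
  obtain P Q where PQ: "P ** Q = mat 1" "Q ** P = mat 1" and T: "(\<lambda>A. P ** A ** Q) ` S = T"
    using assms(1) unfolding equivalent_iff by blast
  obtain P' Q' where PQ': "P' ** Q' = mat 1" "Q' ** P' = mat 1"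
    and U: "(\<lambda>A. P' ** A ** Q') ` T = U"
    using assms(2) unfolding equivalent_iff by blast
  have "(\<lambda>A. (P' ** P) ** A ** (Q ** Q')) ` S = U"
    unfolding U[symmetric] T[symmetric] image_image by (simp add: matrix_mul_assoc)
  moreover have "(P' ** P) ** (Q ** Q') = mat 1" "(Q ** Q') ** (P' ** P) = mat 1"
    by (metis PQ PQ' matrix_mul_assoc matrix_mul_lid)+
  ultimately show ?thesis unfolding equivalent_iff by blast
qed

lemma lie_subalgebra_conj:
  assumes "lie_subalgebra S" and QP: "Q ** P = mat 1"
  shows "lie_subalgebra ((\<lambda>A. P ** A ** Q) ` S)"
proof -
  have "cmat.subspace ((\<lambda>A. P ** A ** Q) ` S)"
    using module_hom.subspace_image[OF linear_conj[unfolded Vector_Spaces.linear_def, THEN conjunct2, THEN conjunct2]]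
      assms unfolding lie_subalgebra_def by blast
  then show ?thesis
    using assms by (auto simp: lie_subalgebra_def A2_def trace_conj[OF QP] conj_lie_br[OF QP, symmetric])
qed

lemma dim_conj:
  assumes QP: "Q ** P = mat 1"
  shows "cmat.dim ((\<lambda>A. P ** A ** Q) ` S) = cmat.dim S"
proof -
  interpret finite_dimensional_vector_space_pair_1 cscale "cmat.extend_basis {}" cscale
    by unfold_locales
  have "inj (\<lambda>A. P ** A ** Q)"
    by (rule inj_on_inverseI[of _ "\<lambda>A. Q ** A ** P"]) (rule conj_conj[OF QP])
  then show ?thesis
    by (rule dim_image_eq[OF linear_conj inj_on_subset[OF _ subset_UNIV]])
qed

section \<open>Generated subalgebras\<close>

lemma generated_eq_span:
  assumes sub: "lie_subalgebra (cmat.span B)" and "W \<subseteq> cmat.span B" "B \<subseteq> cmat.span W"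
  shows "generated W = cmat.span B"
  unfolding generated_def
proof (rule hull_unique)
  fix S assume "W \<subseteq> S" "lie_subalgebra S"
  then have "cmat.span W \<subseteq> S"
    by (intro cmat.span_minimal) (auto simp: lie_subalgebra_def)
  then show "cmat.span B \<subseteq> S"
    using assms(3) \<open>lie_subalgebra S\<close> by (intro cmat.span_minimal) (auto simp: lie_subalgebra_def)
qed (fact assms)+

lemma generated_minimal: "W \<subseteq> S \<Longrightarrow> lie_subalgebra S \<Longrightarrow> generated W \<subseteq> S"
  unfolding generated_def by (rule hull_minimal)

text \<open>Only the conjugated generators have to be computed: the pullback of \<open>S\<close> is
  a subalgebra containing \<open>W\<close>, hence \<open>generated W\<close>, and the common
  dimension 3 gives equality.\<close>

lemma equivalent_generatedI:
  assumes S: "lie_subalgebra S" "cmat.dim S = 3"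
    and W: "lie_subalgebra (generated W)" "cmat.dim (generated W) = 3"
    and PQ: "P ** Q = mat 1" and mem: "\<And>X. X \<in> W \<Longrightarrow> P ** X ** Q \<in> S"
  shows "equivalent S (generated W)"
proof -
  have QP: "Q ** P = mat 1" using PQ matrix_left_right_inverse by blast
  let ?T = "(\<lambda>A. Q ** A ** P) ` S"
  have T: "lie_subalgebra ?T" "cmat.dim ?T = 3"
    using lie_subalgebra_conj[OF S(1) PQ] dim_conj[OF PQ] S(2) by simp_all
  have "W \<subseteq> ?T"
  proof
    fix X assume "X \<in> W"
    then show "X \<in> ?T"
      by (intro image_eqI[of _ _ "P ** X ** Q"] mem) (simp_all add: conj_conj[OF QP])
  qed
  then have "generated W \<subseteq> ?T" by (rule generated_minimal) (rule T)
  then have "generated W = ?T"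
    using W T by (intro subspace_eq_of_dim_eq) (simp_all add: lie_subalgebra_def)
  then show ?thesis unfolding equivalent_iff using PQ QP by blast
qed

section \<open>Isomorphism types\<close>

text \<open>\<open>ad_p\<close> and \<open>ad_q\<close> are the images of \<open>z1\<close> and
  \<open>z2\<close> under ad \<open>z3\<close>. They present all four types uniformly as a line
  acting on the abelian ideal spanned by \<open>z1\<close> and \<open>z2\<close>.\<close>

definition ad_p :: "lie_type \<Rightarrow> complex^3" where
  "ad_p t = (case t of L2 \<Rightarrow> z1 | L3 a \<Rightarrow> z2 | L4 \<Rightarrow> z2 | L5 \<Rightarrow> z2)"

definition ad_q :: "lie_type \<Rightarrow> complex^3" where
  "ad_q t = (case t of L2 \<Rightarrow> z2 | L3 a \<Rightarrow> a *s z1 + z2 | L4 \<Rightarrow> z1 | L5 \<Rightarrow> 0)"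

lemma bracket_eq: "bracket t = z_bracket (ad_p t) (ad_q t)"
  by (cases t) (simp_all add: ad_p_def ad_q_def)

lemma z_nth [simp]:
  "z1 $ 1 = 1" "z1 $ 2 = 0" "z1 $ 3 = 0" "z2 $ 1 = 0" "z2 $ 2 = 1" "z2 $ 3 = 0"
  "z3 $ 1 = 0" "z3 $ 2 = 0" "z3 $ 3 = 1"
  by (simp_all add: z1_def z2_def z3_def axis_def)

lemma ad_nth3 [simp]: "ad_p t $ 3 = 0" "ad_q t $ 3 = 0"
  by (cases t; simp add: ad_p_def ad_q_def)+

text \<open>The matrices play the roles of \<open>z1\<close>, \<open>z2\<close>, \<open>z3\<close>.
  Checking three brackets replaces handling an isomorphism, which \<open>coords\<close>
  recovers.\<close>

definition adapted_basis :: "lie_type \<Rightarrow> cmat3 \<Rightarrow> cmat3 \<Rightarrow> cmat3 \<Rightarrow> bool" where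
  "adapted_basis t A B C \<longleftrightarrow>
     (\<forall>a b c. cscale a A + cscale b B + cscale c C = 0 \<longrightarrow> a = 0 \<and> b = 0 \<and> c = 0) \<and>
     lie_br A B = 0 \<and>
     lie_br C A = cscale (ad_p t $ 1) A + cscale (ad_p t $ 2) B \<and>
     lie_br C B = cscale (ad_q t $ 1) A + cscale (ad_q t $ 2) B"

lemma trace_cscale: "trace (cscale k A) = k * trace A"
  by (cases A rule: m3_cases) (simp add: algebra_simps)

lemma subspace_A2: "cmat.subspace A2"
  using trace_cscale[of 0 0] by (simp add: cmat.subspace_def A2_def trace_add trace_cscale)

context
  fixes t A B C
  assumes basis: "adapted_basis t A B C"
begin

lemma adapted_independent:
  "cscale a A + cscale b B + cscale c C = 0 \<Longrightarrow> a = 0 \<and> b = 0 \<and> c = 0"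
  using basis unfolding adapted_basis_def by blast

lemma adapted_brackets:
  "lie_br A B = 0"
  "lie_br C A = cscale (ad_p t $ 1) A + cscale (ad_p t $ 2) B"
  "lie_br C B = cscale (ad_q t $ 1) A + cscale (ad_q t $ 2) B"
  "lie_br B A = 0"
  "lie_br A C = cscale (- 1) (cscale (ad_p t $ 1) A + cscale (ad_p t $ 2) B)"
  "lie_br B C = cscale (- 1) (cscale (ad_q t $ 1) A + cscale (ad_q t $ 2) B)"
  using basis lie_br_commute[of B A] lie_br_commute[of A C] lie_br_commute[of B C]
  unfolding adapted_basis_def by simp_all

definition coords :: "complex^3 \<Rightarrow> cmat3" where
  "coords u = cscale (u $ 1) A + cscale (u $ 2) B + cscale (u $ 3) C"

lemma coords_add: "coords (u + v) = coords u + coords v"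
  and coords_scale: "coords (k *s u) = cscale k (coords u)"
  by (simp_all add: coords_def algebra_simps)

lemma lie_br_coords: "lie_br (coords u) (coords v) = coords (bracket t u v)"
  unfolding coords_def bracket_eq z_bracket_def
  by (simp add: lie_br_add_left lie_br_add_right lie_br_cscale_left lie_br_cscale_right
      adapted_brackets lie_br_self algebra_simps)

lemma coords_range: "range coords = cmat.span {A, B, C}"
proof -
  have "\<exists>u. coords u = cscale a A + cscale b B + cscale c C" for a b c
    by (rule exI[of _ "vector [a, b, c]"]) (simp add: coords_def)
  then have "X \<in> range coords \<longleftrightarrow> X \<in> cmat.span {A, B, C}" for X
    unfolding span_triple_iff by (metis coords_def rangeE rangeI)
  then show ?thesis by blast
qed

lemma coords_inj: "inj coords"
proof (rule injI)
  fix u v assume "coords u = coords v"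
  moreover have "cscale (u$1 - v$1) A + cscale (u$2 - v$2) B + cscale (u$3 - v$3) C =
      coords u - coords v"
    by (simp add: coords_def algebra_simps)
  ultimately have "cscale (u$1 - v$1) A + cscale (u$2 - v$2) B + cscale (u$3 - v$3) C = 0"
    by simp
  from adapted_independent[OF this] show "u = v"
    by (simp add: vec_eq_iff forall_3)
qed

lemma adapted_has_type: "has_type (cmat.span {A, B, C}) t"
  unfolding has_type_def
proof (intro exI[of _ coords] conjI)
  show "Vector_Spaces.linear (*s) cscale coords"
    by unfold_locales (simp_all add: coords_add coords_scale algebra_simps)
  show "bij_betw coords UNIV (cmat.span {A, B, C})"
    using coords_inj coords_range by (simp add: bij_betw_def)
qed (simp add: lie_br_coords)

lemma adapted_closed:
  assumes "X \<in> cmat.span {A, B, C}" "Y \<in> cmat.span {A, B, C}"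
  shows "lie_br X Y \<in> cmat.span {A, B, C}"
  using assms unfolding coords_range[symmetric] by (auto simp: lie_br_coords)

lemma adapted_dim: "cmat.dim (cmat.span {A, B, C}) = 3"
proof -
  have distinct: "A \<noteq> B" "A \<noteq> C" "B \<noteq> C"
    using adapted_independent[of 1 "-1" 0] adapted_independent[of 1 0 "-1"]
      adapted_independent[of 0 1 "-1"] by auto
  have "cmat.independent {A, B, C}"
  proof (rule cmat.independent_if_scalars_zero)
    fix f X assume "(\<Sum>x\<in>{A, B, C}. cscale (f x) x) = 0" "X \<in> {A, B, C}"
    then show "f X = 0"
      using distinct adapted_independent[of "f A" "f B" "f C"] by (auto simp: add.assoc)
  qed simp
  then show ?thesis
    using distinct cmat.dim_span_eq_card_independent by fastforce
qed

text \<open>All brackets fall into the span of \<open>A\<close> and \<open>B\<close>, which is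
  abelian, so two derivations reach zero.\<close>

lemma adapted_solvable: "solvable (cmat.span {A, B, C})"
proof -
  let ?D = "derived_series (cmat.span {A, B, C})"
  have "?D 1 \<subseteq> cmat.span {A, B}"
    unfolding One_nat_def derived_series.simps
  proof (rule cmat.span_minimal[OF _ cmat.subspace_span], clarify)
    fix X Y assume "X \<in> cmat.span {A, B, C}" "Y \<in> cmat.span {A, B, C}"
    then obtain u v where "X = coords u" "Y = coords v" by (auto simp: coords_range[symmetric])
    then have "lie_br X Y = coords (bracket t u v)" by (simp add: lie_br_coords)
    also have "\<dots> \<in> cmat.span {A, B}"
      by (auto simp: coords_def bracket_eq z_bracket_def intro!: cmat.span_add cmat.span_scale
          intro: cmat.span_base)
    finally show "lie_br X Y \<in> cmat.span {A, B}" .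
  qed
  moreover have "lie_br X Y = 0" if "X \<in> cmat.span {A, B}" "Y \<in> cmat.span {A, B}" for X Y
  proof -
    have "\<exists>a b. X = cscale a A + cscale b B" if "X \<in> cmat.span {A, B}" for X
    proof -
      from that obtain a where "X - cscale a A \<in> cmat.span {B}"
        by (auto simp: cmat.span_breakdown_eq)
      then obtain b where "X - cscale a A - cscale b B = 0"
        by (auto simp: cmat.span_breakdown_eq)
      then show ?thesis by (simp add: algebra_simps) blast
    qed
    with that obtain a b c d where "X = cscale a A + cscale b B" "Y = cscale c A + cscale d B"
      by meson
    then show ?thesis
      by (simp add: lie_br_add_left lie_br_add_right lie_br_cscale_left lie_br_cscale_right
          adapted_brackets lie_br_self)
  qed
  ultimately have "{lie_br X Y | X Y. X \<in> ?D 1 \<and> Y \<in> ?D 1} \<subseteq> {0}" by blast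
  then have "?D (Suc 1) \<subseteq> {0}"
    unfolding derived_series.simps by (rule cmat.span_minimal) (rule cmat.subspace_single_0)
  moreover have "0 \<in> ?D (Suc 1)" by (simp add: cmat.span_zero)
  ultimately show ?thesis unfolding solvable_def by blast
qed

end

lemma has_type_equivalent:
  assumes "has_type S t" "equivalent S T" shows "has_type T t"
proof -
  obtain \<phi> where lin: "Vector_Spaces.linear (*s) cscale \<phi>" and bij: "bij_betw \<phi> UNIV S"
    and br: "\<And>u v. \<phi> (bracket t u v) = lie_br (\<phi> u) (\<phi> v)"
    using assms(1) unfolding has_type_def by blast
  obtain P Q where PQ: "P ** Q = mat 1" "Q ** P = mat 1" and T: "(\<lambda>A. P ** A ** Q) ` S = T"
    using assms(2) unfolding equivalent_iff by blast
  have "bij_betw (\<lambda>A. P ** A ** Q) S T"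
    unfolding bij_betw_def
    using T inj_on_inverseI[of S "\<lambda>A. Q ** A ** P" "\<lambda>A. P ** A ** Q"] conj_conj[OF PQ(2)] by simp
  then have "bij_betw ((\<lambda>A. P ** A ** Q) \<circ> \<phi>) UNIV T"
    using bij by (rule bij_betw_trans[rotated])
  moreover have "Vector_Spaces.linear (*s) cscale ((\<lambda>A. P ** A ** Q) \<circ> \<phi>)"
    using lin linear_conj by (rule Vector_Spaces.linear_compose)
  ultimately show ?thesis
    unfolding has_type_def
    by (intro exI[of _ "(\<lambda>A. P ** A ** Q) \<circ> \<phi>"]) (simp add: br conj_lie_br[OF PQ(2)])
qed

lemma has_type_isomorphism:
  assumes "has_type S t" "has_type S t'"
  obtains \<psi> where "Vector_Spaces.linear (*s) (*s) \<psi>" "bij \<psi>"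
    "\<And>u v. \<psi> (bracket t u v) = bracket t' (\<psi> u) (\<psi> v)"
proof -
  obtain \<phi> where lin: "Vector_Spaces.linear (*s) cscale \<phi>" and bij: "bij_betw \<phi> UNIV S"
    and br: "\<And>u v. \<phi> (bracket t u v) = lie_br (\<phi> u) (\<phi> v)"
    using assms(1) unfolding has_type_def by blast
  obtain \<phi>' where lin': "Vector_Spaces.linear (*s) cscale \<phi>'" and bij': "bij_betw \<phi>' UNIV S"
    and br': "\<And>u v. \<phi>' (bracket t' u v) = lie_br (\<phi>' u) (\<phi>' v)"
    using assms(2) unfolding has_type_def by blast
  interpret L: Vector_Spaces.linear "(*s)" cscale \<phi> by fact
  interpret L': Vector_Spaces.linear "(*s)" cscale \<phi>' by fact
  define \<psi> where "\<psi> = inv_into UNIV \<phi>' \<circ> \<phi>"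
  have range: "\<phi> u \<in> range \<phi>'" for u
    using bij bij' by (auto simp: bij_betw_def)
  then have \<psi>: "\<phi>' (\<psi> u) = \<phi> u" for u
    by (simp add: \<psi>_def f_inv_into_f)
  have inj: "\<phi>' u = \<phi>' v \<longleftrightarrow> u = v" for u v
    using bij' by (auto simp: bij_betw_def inj_eq)
  have "Vector_Spaces.linear (*s) (*s) \<psi>"
  proof unfold_locales
    show "\<psi> (u + v) = \<psi> u + \<psi> v" for u v
      by (subst inj[symmetric]) (simp add: L.add L'.add \<psi>)
    show "\<psi> (k *s u) = k *s \<psi> u" for k u
      by (subst inj[symmetric]) (simp add: L.scale L'.scale \<psi>)
  qed
  moreover have "bij \<psi>"
    unfolding \<psi>_def using bij bij' by (metis bij_betw_inv_into bij_betw_trans)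
  moreover have "\<psi> (bracket t u v) = bracket t' (\<psi> u) (\<psi> v)" for u v
    by (subst inj[symmetric]) (simp add: br br' \<psi>)
  ultimately show thesis by (rule that)
qed

section \<open>Trace forms of the adjoint representation\<close>

definition ad_matrix :: "lie_type \<Rightarrow> complex^3 \<Rightarrow> cmat3" where
  "ad_matrix t u =
     (let p = ad_p t; q = ad_q t in
      m3 (u$3 * p$1) (u$3 * q$1) (- (u$1 * p$1 + u$2 * q$1))
         (u$3 * p$2) (u$3 * q$2) (- (u$1 * p$2 + u$2 * q$2))
         0 0 0)"

lemma ad_matrix_mult: "ad_matrix t u *v v = bracket t u v"
  by (simp add: ad_matrix_def Let_def bracket_eq z_bracket_def vec_eq_iff forall_3
      matrix_vector_mult_def sum_3 algebra_simps)

definition "ad_trace t = ad_p t $ 1 + ad_q t $ 2"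
definition "ad_square_trace t = (ad_p t $ 1)\<^sup>2 + 2 * ad_p t $ 2 * ad_q t $ 1 + (ad_q t $ 2)\<^sup>2"

lemma trace_ad_matrix:
  "trace (ad_matrix t u) = u$3 * ad_trace t"
  "trace (ad_matrix t u ** ad_matrix t u) = (u$3)\<^sup>2 * ad_square_trace t"
  by (simp_all add: ad_matrix_def Let_def ad_trace_def ad_square_trace_def power2_eq_square
      algebra_simps)

lemma ad_trace_values:
  "ad_trace L2 = 2" "ad_trace (L3 a) = 1" "ad_trace L4 = 0" "ad_trace L5 = 0"
  "ad_square_trace L2 = 2" "ad_square_trace (L3 a) = 1 + 2 * a" "ad_square_trace L4 = 2"
  "ad_square_trace L5 = 0"
  by (simp_all add: ad_trace_def ad_square_trace_def ad_p_def ad_q_def)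

text \<open>The matrix of an isomorphism conjugates ad u into ad of the image of u, so traces agree.
  For u = \<open>z3\<close> one side yields the constants of \<open>t\<close>; on the other only the
  third coordinate of the image survives, and this is the factor \<open>x\<close>.\<close>

lemma has_type_scaling:
  assumes "has_type S t" "has_type S t'"
  shows "\<exists>x. ad_trace t = x * ad_trace t' \<and> ad_square_trace t = x\<^sup>2 * ad_square_trace t'"
proof -
  obtain \<psi> where lin: "Vector_Spaces.linear (*s) (*s) \<psi>" and "bij \<psi>"
    and br: "\<And>u v. \<psi> (bracket t u v) = bracket t' (\<psi> u) (\<psi> v)"
    using has_type_isomorphism[OF assms] by blast
  define P where "P = matrix \<psi>"
  have P: "P *v u = \<psi> u" for u
    unfolding P_def using lin by (simp add: matrix_works)
  have "surj ((*v) P)" using \<open>bij \<psi>\<close> P by (simp add: bij_def surj_def)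
  then obtain Q where PQ: "P ** Q = mat 1"
    using matrix_right_invertible_surjective by blast
  then have QP: "Q ** P = mat 1" using matrix_left_right_inverse by blast
  have "P ** ad_matrix t u = ad_matrix t' (\<psi> u) ** P" for u
    by (simp add: matrix_eq flip: matrix_vector_mul_assoc) (simp add: ad_matrix_mult P br)
  then have ad: "P ** ad_matrix t u ** Q = ad_matrix t' (\<psi> u)" for u
    by (metis PQ matrix_mul_assoc matrix_mul_rid)
  let ?A = "ad_matrix t z3" and ?B = "ad_matrix t' (\<psi> z3)"
  have "P ** (?A ** ?A) ** Q = ?B ** ?B"
    unfolding ad[symmetric] by (metis QP matrix_mul_assoc matrix_mul_rid)
  then have "trace ?B = trace ?A" "trace (?B ** ?B) = trace (?A ** ?A)"
    using trace_conj[OF QP] ad by metis+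
  then show ?thesis
    by (intro exI[of _ "\<psi> z3 $ 3"]) (simp add: trace_ad_matrix)
qed

text \<open>The trace test fails to separate \<open>L2\<close> from \<open>L3 (- (1 / 4))\<close>,
  which match with factor 2. But in \<open>L2\<close> every bracket is a combination of its two
  arguments, whereas in \<open>L3 a\<close> the bracket of \<open>z3\<close> and \<open>z1\<close>
  is \<open>z2\<close>.\<close>

lemma has_type_L2_not_L3:
  assumes "has_type S L2" shows "\<not> has_type S (L3 a)"
proof
  assume "has_type S (L3 a)"
  then obtain \<psi> where lin: "Vector_Spaces.linear (*s) (*s) \<psi>" and bij: "bij \<psi>"
    and br: "\<And>u v. \<psi> (bracket L2 u v) = bracket (L3 a) (\<psi> u) (\<psi> v)"
    using has_type_isomorphism[OF assms] by blast
  interpret Vector_Spaces.linear "(*s)" "(*s)" \<psi> by fact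
  obtain u v where uv: "\<psi> u = z3" "\<psi> v = z1"
    using bij by (metis bij_pointE)
  have "bracket L2 u v = u$3 *s v - v$3 *s u"
    by (simp add: z_bracket_def vec_eq_iff forall_3)
  then have "bracket (L3 a) z3 z1 = u$3 *s z1 - v$3 *s z3"
    using br[of u v] uv by (simp add: diff scale)
  then have "bracket (L3 a) z3 z1 $ 2 = (u$3 *s z1 - v$3 *s z3) $ 2"
    by (rule arg_cong)
  then show False by (simp add: z_bracket_def)
qed

lemma has_type_unique:
  assumes t: "has_type S t" and t': "has_type S t'"
  shows "t = t'"
proof -
  have "t \<noteq> L2 \<or> t' \<noteq> L3 a" "t' \<noteq> L2 \<or> t \<noteq> L3 a" for a
    using t t' has_type_L2_not_L3 by blast+
  then show ?thesis
    \<comment> \<open>The factor may be 0, which would relate \<open>L5\<close> to any type;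
      applying the test in both directions excludes this.\<close>
    using has_type_scaling[OF t t'] has_type_scaling[OF t' t]
    by (cases t; cases t') (auto simp: ad_trace_values)
qed

section \<open>The listed subalgebras\<close>

text \<open>The span of the adapted basis has dimension 3 and lies in a space spanned by three
  elements, so the two spans coincide and every property transfers.\<close>

lemma generated_triple:
  assumes basis: "adapted_basis t A B C"
    and W: "X \<in> A2" "Y \<in> A2" "Z \<in> A2" and mem: "{A, B, C} \<subseteq> cmat.span {X, Y, Z}"
  shows "generated {X, Y, Z} = cmat.span {X, Y, Z}" (is ?gen)
    and "lie_subalgebra (generated {X, Y, Z}) \<and> cmat.dim (generated {X, Y, Z}) = 3 \<and>
      solvable (generated {X, Y, Z}) \<and> has_type (generated {X, Y, Z}) t"
proof -
  let ?S = "cmat.span {X, Y, Z}"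
  have "cmat.span {A, B, C} \<subseteq> ?S"
    using mem by (rule cmat.span_minimal) (rule cmat.subspace_span)
  moreover have "cmat.dim ?S \<le> card {X, Y, Z}"
    by (rule cmat.dim_le_card) auto
  then have "cmat.dim ?S \<le> 3"
    by (rule order_trans) (simp add: card_insert_if)
  moreover have "cmat.dim (cmat.span {A, B, C}) = 3" by (rule adapted_dim[OF basis])
  ultimately have eq: "cmat.span {A, B, C} = ?S"
    using cmat_fin.dim_subset[of "cmat.span {A, B, C}" ?S]
    by (intro subspace_eq_of_dim_eq cmat.subspace_span) auto
  have "?S \<subseteq> A2" using W by (intro cmat.span_minimal subspace_A2) auto
  then have sub: "lie_subalgebra ?S"
    using adapted_closed[OF basis] cmat.subspace_span unfolding lie_subalgebra_def eq by blast
  show gen: ?gen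
    using sub by (rule generated_eq_span) (auto intro: cmat.span_base)
  show "lie_subalgebra (generated {X, Y, Z}) \<and> cmat.dim (generated {X, Y, Z}) = 3 \<and>
      solvable (generated {X, Y, Z}) \<and> has_type (generated {X, Y, Z}) t"
    unfolding gen using sub adapted_dim[OF basis] adapted_solvable[OF basis] adapted_has_type[OF basis]
    unfolding eq by blast
qed

primrec listed_generators :: "label \<Rightarrow> cmat3 \<times> cmat3 \<times> cmat3" where
  "listed_generators L2_1 = (x1, x3, cscale 2 h1 + h2)"
| "listed_generators L2_2 = (x1, y2, h1 - h2)"
| "listed_generators L3_quarter_1 = (x1, x3, cscale 2 h1 + h2 + x2)"
| "listed_generators L3_quarter_2 = (y1, y3, cscale 2 h1 + h2 + x2)"
| "listed_generators L3_two_ninths_1 = (x1 + x2, x3, h1 + h2)"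
| "listed_generators L3_zero_1 = (x1, h1, h2)"
| "listed_generators (L3_family_1 \<alpha>) = (x1, x3, cscale (\<alpha> - 1) h1 + cscale \<alpha> h2)"
| "listed_generators (L3_family_2 \<alpha>) = (x1, y2, h1 + cscale \<alpha> h2)"
| "listed_generators L4_1 = (x1, x3, h2)"
| "listed_generators L4_2 = (x1, y2, h1 + h2)"
| "listed_generators L5_1 = (x1, x2, x3)"

lemma listed_eq: "listed_generators l = (X, Y, Z) \<Longrightarrow> listed l = generated {X, Y, Z}"
  by (cases l) auto

text \<open>
  The coordinates in \<open>X, Y, Z\<close> of an adapted basis. If \<open>Z\<close> acts on \<open>\<langle>X, Y\<rangle>\<close> with distinct eigenvalues
  \<open>\<kappa>, \<mu>\<close>, then \<open>X + Y\<close> is a cyclic vector, and for \<open>L3\<close> one rescales to \<open>\<kappa> + \<mu> = 1\<close>, \<open>a = - \<kappa> \<mu>\<close>.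
\<close>

primrec basis_coords :: "label \<Rightarrow> (complex \<times> complex \<times> complex) \<times> (complex \<times> complex \<times> complex) \<times>
    (complex \<times> complex \<times> complex)" where
  "basis_coords L2_1 = ((1, 0, 0), (0, 1, 0), (0, 0, 1 / 3))"
| "basis_coords L2_2 = ((1, 0, 0), (0, 1, 0), (0, 0, 1 / 3))"
| "basis_coords L3_quarter_1 = ((1, 0, 0), (1 / 2, 1 / 6, 0), (0, 0, 1 / 6))"
| "basis_coords L3_quarter_2 = ((0, 1, 0), (1 / 6, 1 / 2, 0), (0, 0, - 1 / 6))"
| "basis_coords L3_two_ninths_1 = ((1, 1, 0), (1 / 3, 2 / 3, 0), (0, 0, 1 / 3))"
| "basis_coords L3_zero_1 = ((1, 1, 2), (1, 0, 0), (0, 1 / 2, 0))"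
| "basis_coords (L3_family_1 \<alpha>) = ((1, 1, 0),
     ((\<alpha> - 2) / (3 * (\<alpha> - 1)), (2 * \<alpha> - 1) / (3 * (\<alpha> - 1)), 0), (0, 0, 1 / (3 * (\<alpha> - 1))))"
| "basis_coords (L3_family_2 \<alpha>) = ((1, 1, 0),
     ((\<alpha> - 2) / (3 * (\<alpha> - 1)), (2 * \<alpha> - 1) / (3 * (\<alpha> - 1)), 0), (0, 0, - 1 / (3 * (\<alpha> - 1))))"
| "basis_coords L4_1 = ((1, 1, 0), (- 1, 1, 0), (0, 0, 1))"
| "basis_coords L4_2 = ((1, 1, 0), (1, - 1, 0), (0, 0, 1))"
| "basis_coords L5_1 = ((0, 1, 0), (0, 0, - 1), (1, 0, 0))"

definition combine :: "cmat3 \<times> cmat3 \<times> cmat3 \<Rightarrow> complex \<times> complex \<times> complex \<Rightarrow> cmat3" where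
  "combine = (\<lambda>(X, Y, Z) (a, b, c). cscale a X + cscale b Y + cscale c Z)"

text \<open>The last bracket is Cayley-Hamilton for ad \<open>C\<close> on the plane of
  \<open>X\<close> and \<open>Y\<close>: applied twice to \<open>X + Y\<close> it gives \<kappa> +
  \<mu> = 1 times the first image minus \<kappa>\<mu> times \<open>X + Y\<close>. Distinct
  eigenvalues make \<open>X + Y\<close> and its image independent.\<close>

lemma adapted_basis_L3:
  assumes ind: "\<And>a b c. cscale a X + cscale b Y + cscale c C = 0 \<Longrightarrow> a = 0 \<and> b = 0 \<and> c = 0"
    and br: "lie_br X Y = 0" "lie_br C X = cscale \<kappa> X" "lie_br C Y = cscale \<mu> Y"
    and ev: "\<kappa> + \<mu> = 1" "\<kappa> \<noteq> \<mu>"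
  shows "adapted_basis (L3 (- (\<kappa> * \<mu>))) (X + Y) (cscale \<kappa> X + cscale \<mu> Y) C"
proof -
  have \<mu>: "\<mu> = 1 - \<kappa>" using ev by (simp add: eq_diff_eq add.commute)
  have "lie_br Y X = 0" using br(1) lie_br_commute[of Y X] by simp
  moreover have "a = 0 \<and> b = 0 \<and> c = 0"
    if "cscale a (X + Y) + cscale b (cscale \<kappa> X + cscale \<mu> Y) + cscale c C = 0" for a b c
  proof -
    have "cscale (a + b * \<kappa>) X + cscale (a + b * \<mu>) Y + cscale c C = 0"
      using that by (simp add: cmat.scale_left_distrib cmat.scale_right_distrib ac_simps)
    from ind[OF this] have "a + b * \<kappa> = 0" "a + b * \<mu> = 0" "c = 0" by blast+
    moreover from this have "b * (\<kappa> - \<mu>) = 0" by (simp add: algebra_simps add_eq_0_iff)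
    ultimately show ?thesis using ev by simp
  qed
  moreover have "\<mu> * \<mu> = \<mu> - \<kappa> * \<mu>" "\<kappa> * \<kappa> = \<kappa> - \<kappa> * \<mu>"
    unfolding \<mu> by (simp_all add: algebra_simps)
  then have "cscale (\<mu> * \<mu>) Y = cscale \<mu> Y - cscale (\<kappa> * \<mu>) Y"
    "cscale (\<kappa> * \<kappa>) X = cscale \<kappa> X - cscale (\<kappa> * \<mu>) X"
    by (simp_all only: cmat.scale_left_diff_distrib)
  ultimately show ?thesis
    unfolding adapted_basis_def
    by (intro conjI; (blast | simp add: ad_p_def ad_q_def lie_br_add_left lie_br_add_right
        lie_br_cscale_left lie_br_cscale_right lie_br_self br cmat.scale_right_distrib))
qed

lemma listed_adapted_basis:
  assumes "admissible l" "listed_generators l = W" "basis_coords l = (a, b, c)"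
  shows "adapted_basis (subscript l) (combine W a) (combine W b) (combine W c)"
proof (cases "\<exists>\<alpha>. l = L3_family_1 \<alpha> \<or> l = L3_family_2 \<alpha>")
  case False
  show ?thesis
  proof (cases "l = L3_two_ninths_1")
    case True
    \<comment> \<open>\<open>h1 + h2\<close> has weight 1 on \<open>x1 + x2\<close> and weight 2 on
      \<open>x3\<close>; division by 3 makes the sum 1.\<close>
    have "adapted_basis (L3 (- (1 / 3 * (2 / 3)))) (x1 + x2 + x3)
        (cscale (1 / 3) (x1 + x2) + cscale (2 / 3) x3) (cscale (1 / 3) (h1 + h2))"
      by (rule adapted_basis_L3) (auto simp: generators_m3 lie_br_def)
    then show ?thesis using assms True by (auto simp: combine_def)
  next
    case False
    with \<open>\<nexists>\<alpha>. l = L3_family_1 \<alpha> \<or> l = L3_family_2 \<alpha>\<close> assms show ?thesis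
      by (cases l) (auto simp: adapted_basis_def generators_m3 combine_def lie_br_def ad_p_def ad_q_def)
  qed
next
  case True
  then obtain \<alpha> where l: "l = L3_family_1 \<alpha> \<or> l = L3_family_2 \<alpha>" by blast
  then have \<alpha>: "\<alpha> \<noteq> 1" "\<alpha> \<noteq> -1" using assms(1) by auto
  \<comment> \<open>The weights of the third generator on the first two add up to 3(\<alpha> - 1) in
    the first family and to its negative in the second; hence \<open>s\<close>, and the sign in
    \<open>\<sigma>\<close> below.\<close>
  define s where "s = 1 / (3 * (\<alpha> - 1))"
  define \<kappa> \<mu> where "\<kappa> = s * (\<alpha> - 2)" and "\<mu> = s * (2 * \<alpha> - 1)"
  have s: "s * (3 * (\<alpha> - 1)) = 1" "s \<noteq> 0" using \<alpha> by (simp_all add: s_def)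
  have ev: "\<kappa> + \<mu> = 1" "\<kappa> \<noteq> \<mu>"
  proof -
    have "\<kappa> + \<mu> = s * (3 * (\<alpha> - 1))" by (simp add: \<kappa>_def \<mu>_def algebra_simps)
    then show "\<kappa> + \<mu> = 1" by (simp only: s)
    have "\<mu> - \<kappa> = s * (\<alpha> + 1)" by (simp add: \<kappa>_def \<mu>_def algebra_simps)
    then show "\<kappa> \<noteq> \<mu>" using s \<alpha> by (auto simp: add_eq_0_iff2)
  qed
  have sub: "subscript l = L3 (- (\<kappa> * \<mu>))"
    using l by (auto simp: \<kappa>_def \<mu>_def s_def power2_eq_square algebra_simps)
  obtain X Y Z where W: "W = (X, Y, Z)" by (cases W)
  define \<sigma> where "\<sigma> = (if l = L3_family_1 \<alpha> then s else - s)"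
  have \<sigma>: "\<sigma> \<in> {s, - s}" by (simp add: \<sigma>_def)
  have abc: "a = (1, 1, 0)" "b = (\<kappa>, \<mu>, 0)" "c = (0, 0, \<sigma>)"
    using l assms by (auto simp: \<kappa>_def \<mu>_def \<sigma>_def s_def)
  have br: "lie_br (cscale \<sigma> Z) X = cscale \<kappa> X" "lie_br (cscale \<sigma> Z) Y = cscale \<mu> Y"
    using l assms(2) W by (auto simp: \<kappa>_def \<mu>_def \<sigma>_def generators_m3 lie_br_def algebra_simps)
  have "adapted_basis (L3 (- (\<kappa> * \<mu>))) (X + Y) (cscale \<kappa> X + cscale \<mu> Y) (cscale \<sigma> Z)"
  proof (rule adapted_basis_L3[OF _ _ br ev])
    show "lie_br X Y = 0" using l assms W by (auto simp: generators_m3 lie_br_def)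
    show "p = 0 \<and> q = 0 \<and> r = 0" if "cscale p X + cscale q Y + cscale r (cscale \<sigma> Z) = 0" for p q r
      using that l assms W \<sigma> s(2) by (auto simp: generators_m3)
  qed
  then show ?thesis unfolding sub W abc by (simp add: combine_def)
qed

lemma
  assumes "admissible l"
  shows listed_span: "listed_generators l = (X, Y, Z) \<Longrightarrow> listed l = cmat.span {X, Y, Z}"
    and listed_correct: "lie_subalgebra (listed l) \<and> cmat.dim (listed l) = 3 \<and> solvable (listed l) \<and>
        has_type (listed l) (subscript l)"
proof -
  obtain X Y Z where W: "listed_generators l = (X, Y, Z)" by (metis prod_cases3)
  obtain a b c where abc: "basis_coords l = (a, b, c)" by (metis prod_cases3)
  have "X \<in> A2" "Y \<in> A2" "Z \<in> A2"
    using W by (cases l; force simp: generators_m3 A2_def)+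
  moreover have "combine (X, Y, Z) d \<in> cmat.span {X, Y, Z}" for d
    by (cases d) (auto simp: combine_def span_triple_iff)
  ultimately have *: "generated {X, Y, Z} = cmat.span {X, Y, Z}"
    "lie_subalgebra (generated {X, Y, Z}) \<and> cmat.dim (generated {X, Y, Z}) = 3 \<and>
      solvable (generated {X, Y, Z}) \<and> has_type (generated {X, Y, Z}) (subscript l)"
    using generated_triple[OF listed_adapted_basis[OF assms W abc], of X Y Z] by blast+
  then show "lie_subalgebra (listed l) \<and> cmat.dim (listed l) = 3 \<and> solvable (listed l) \<and>
        has_type (listed l) (subscript l)"
    by (simp add: listed_eq[OF W])
  show "listed l = cmat.span {X', Y', Z'}" if "listed_generators l = (X', Y', Z')" for X' Y' Z'
    using that W * by (simp add: listed_eq[OF W])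
qed

section \<open>Nilpotent elements as a conjugation invariant\<close>

definition nilpotents :: "cmat3 set \<Rightarrow> cmat3 set" where
  "nilpotents S = {A \<in> S. A ** A ** A = 0}"

definition outer :: "complex^3 \<Rightarrow> complex^3 \<Rightarrow> cmat3" where
  "outer u v = (\<chi> i j. u $ i * v $ j)"

text \<open>All nilpotent elements have their image in one line. When that line is a coordinate axis
  they occupy a single row, hence the name; for \<open>column_type\<close> they all vanish on one
  common plane.\<close>

definition row_type :: "cmat3 set \<Rightarrow> bool" where
  "row_type S \<longleftrightarrow> (\<exists>u. \<forall>A\<in>nilpotents S. \<exists>v. A = outer u v)"

definition column_type :: "cmat3 set \<Rightarrow> bool" where
  "column_type S \<longleftrightarrow> (\<exists>v. \<forall>A\<in>nilpotents S. \<exists>u. A = outer u v)"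

lemma conj_outer: "P ** outer u v ** Q = outer (P *v u) (v v* Q)"
  by (simp add: vec_eq_iff outer_def matrix_matrix_mult_def matrix_vector_mult_def
      vector_matrix_mult_def sum_distrib_left sum_distrib_right sum_product mult.assoc mult.commute
      mult.left_commute)

lemma nilpotents_conj:
  assumes "Q ** P = mat 1"
  shows "nilpotents ((\<lambda>A. P ** A ** Q) ` S) = (\<lambda>A. P ** A ** Q) ` nilpotents S"
proof -
  have "P ** A ** Q ** (P ** A ** Q) ** (P ** A ** Q) = P ** (A ** A ** A) ** Q" for A :: cmat3
    by (simp add: conj_mult[OF assms])
  moreover have "P ** B ** Q = 0 \<longleftrightarrow> B = 0" for B
    using conj_conj[OF assms, of B] conj_cscale[of P 0 B Q] conj_cscale[of Q 0 "P ** B ** Q" P] by auto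
  ultimately show ?thesis by (auto simp: nilpotents_def)
qed

lemma row_type_equivalent: "equivalent S T \<Longrightarrow> row_type S \<Longrightarrow> row_type T"
  and column_type_equivalent: "equivalent S T \<Longrightarrow> column_type S \<Longrightarrow> column_type T"
  unfolding equivalent_iff row_type_def column_type_def
  by (clarsimp simp: nilpotents_conj; metis conj_outer)+

lemma nilpotents_listed:
  assumes "admissible l" "listed_generators l = (X, Y, Z)"
  shows "A \<in> nilpotents (listed l) \<longleftrightarrow>
    (\<exists>a b c. A = cscale a X + cscale b Y + cscale c Z \<and> A ** A ** A = 0)"
  using listed_span[OF assms] by (auto simp: nilpotents_def span_triple_iff)

section \<open>Lie's theorem in dimension three\<close>

lemma cscale_mult_vec: "cscale k A *v w = k *s (A *v w)"
  by (simp add: cscale_def matrix_vector_mult_def vec_eq_iff sum_distrib_left mult.assoc)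

lemma cayley_hamilton_3:
  "\<exists>s1 s2 s3. \<forall>w. A *v (A *v (A *v w)) = s1 *s (A *v (A *v w)) + s2 *s (A *v w) + s3 *s (w :: complex^3)"
proof -
  let ?s2 = "A$1$2 * A$2$1 + A$1$3 * A$3$1 + A$2$3 * A$3$2
    - A$1$1 * A$2$2 - A$1$1 * A$3$3 - A$2$2 * A$3$3"
  have CH: "A ** A ** A = cscale (trace A) (A ** A) + cscale ?s2 A + cscale (det A) (mat 1)"
    by (cases A rule: m3_cases) (simp add: m3_one algebra_simps)
  have "A *v (A *v (A *v w)) = trace A *s (A *v (A *v w)) + ?s2 *s (A *v w) + det A *s w" for w
  proof -
    have "A *v (A *v (A *v w)) = (A ** A ** A) *v w" by (simp add: matrix_vector_mul_assoc matrix_mul_assoc)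
    also have "\<dots> = trace A *s ((A ** A) *v w) + ?s2 *s (A *v w) + det A *s w"
      unfolding CH by (simp only: matrix_vector_mult_add_rdistrib cscale_mult_vec matrix_vector_mul_lid)
    finally show ?thesis by (simp add: matrix_vector_mul_assoc)
  qed
  then show ?thesis by blast
qed

lemma cubic_factorization:
  fixes s1 s2 s3 :: complex
  shows "\<exists>a b c. s1 = a + b + c \<and> s2 = - (a * b + b * c + c * a) \<and> s3 = a * b * c"
proof -
  have "\<not> constant (poly [:- s3, - s2, - s1, 1:])"
    by (simp add: constant_degree)
  then obtain a where "poly [:- s3, - s2, - s1, 1:] a = 0"
    using fundamental_theorem_of_algebra by blast
  then have a: "a * a * a = s1 * (a * a) + s2 * a + s3"
    by (simp add: algebra_simps)
  \<comment> \<open>Dividing X^3 - s1 X^2 - s2 X - s3 by X - a leaves X^2 - p X + q, with roots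
    \<open>b\<close> and \<open>p - b\<close>.\<close>
  define p where "p = s1 - a"
  define q where "q = a * a - s1 * a - s2"
  define b where "b = (p + csqrt (p\<^sup>2 - 4 * q)) / 2"
  have "2 * b = p + csqrt (p\<^sup>2 - 4 * q)"
    unfolding b_def by (metis nonzero_mult_div_cancel_left times_divide_eq_right zero_neq_numeral)
  then have "(2 * b - p)\<^sup>2 = p\<^sup>2 - 4 * q" by simp
  then have "4 * (b * (p - b)) = 4 * q" by (simp add: power2_eq_square algebra_simps)
  then have q: "b * (p - b) = q" by (simp only: mult_cancel_left) simp
  have "s2 = - (a * b + b * (p - b) + (p - b) * a)"
    unfolding q by (simp add: q_def p_def algebra_simps)
  moreover have "s3 = a * (b * (p - b))"
    unfolding q using a by (simp add: q_def algebra_simps)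
  ultimately show ?thesis
    by (intro exI[of _ a] exI[of _ b] exI[of _ "p - b"]) (simp add: p_def mult.assoc)
qed

text \<open>Since (A - a)(A - b)(A - c) = 0, the last nonzero vector among w, (A - c) w and (A -
  b)(A - c) w is an eigenvector, and it has not left \<open>W\<close>.\<close>

lemma eigenvector_in_invariant_subspace:
  fixes A :: cmat3
  assumes W: "vec.subspace W" and inv: "\<And>w. w \<in> W \<Longrightarrow> A *v w \<in> W" and w: "w \<in> W" "w \<noteq> 0"
  obtains v c where "v \<in> W" "v \<noteq> 0" "A *v v = c *s v"
proof -
  obtain s1 s2 s3 where
    CH: "\<And>w. A *v (A *v (A *v w)) = s1 *s (A *v (A *v w)) + s2 *s (A *v w) + s3 *s w"
    using cayley_hamilton_3 by blast
  obtain a b c where abc: "s1 = a + b + c" "s2 = - (a * b + b * c + c * a)" "s3 = a * b * c"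
    using cubic_factorization by blast
  define D where "D k u = A *v u - k *s u" for k u
  have D_mem: "D k u \<in> W" if "u \<in> W" for k u
    unfolding D_def using W that inv by (intro vec.subspace_diff vec.subspace_scale)
  have D_eig: "A *v u = k *s u" if "D k u = 0" for k u
    using that by (simp add: D_def)
  have D0: "D a (D b (D c w)) = 0"
    unfolding D_def matrix_vector_mult_diff_distrib vec.scale CH abc
    by (simp add: vec_eq_iff algebra_simps)
  consider "D c w = 0" | "D c w \<noteq> 0" "D b (D c w) = 0" | "D b (D c w) \<noteq> 0" by blast
  then show thesis
    by cases (use that D_mem D_eig D0 w in blast)+
qed

lemma mult_lie_br: "X *v (T *v w) = T *v (X *v w) - lie_br T X *v (w :: complex^3)"
  by (simp add: lie_br_def matrix_vector_mult_diff_rdistrib matrix_vector_mul_assoc)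

text \<open>
  The invariance lemma of Lie's theorem: with \<open>N = X - \<lambda>(X)\<close> and \<open>\<mu> = \<lambda>([T, X])\<close> one finds
  \<open>N\<^sup>k T\<^sup>k v = (- \<mu>)\<^sup>k k! v\<close>. In dimension 3 the vectors \<open>T\<^sup>k v\<close>, \<open>k \<le> 3\<close>, and the
  Cayley-Hamilton theorem for \<open>N\<close> suffice to force \<open>\<mu> = 0\<close>.
\<close>

lemma weight_vanishes_on_bracket:
  assumes ideal: "\<And>X. X \<in> I \<Longrightarrow> lie_br T X \<in> I"
    and l: "\<And>X. X \<in> I \<Longrightarrow> X *v v = l X *s v" and v: "v \<noteq> 0" and X: "X \<in> I"
  shows "l (lie_br T X) = 0"
proof -
  define Y Z where "Y = lie_br T X" and "Z = lie_br T Y"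
  have mem: "Y \<in> I" "Z \<in> I" "lie_br T Z \<in> I" using X ideal by (simp_all add: Y_def Z_def)
  define x \<mu> \<zeta> \<eta> where "x = l X" and "\<mu> = l Y" and "\<zeta> = l Z" and "\<eta> = l (lie_br T Z)"
  define v1 v2 v3 where "v1 = T *v v" and "v2 = T *v v1" and "v3 = T *v v2"
  have 0: "X *v v = x *s v" "Y *v v = \<mu> *s v" "Z *v v = \<zeta> *s v" "lie_br T Z *v v = \<eta> *s v"
    using l X mem by (simp_all add: x_def \<mu>_def \<zeta>_def \<eta>_def)
  have 1: "X *v v1 = x *s v1 - \<mu> *s v" "Y *v v1 = \<mu> *s v1 - \<zeta> *s v" "Z *v v1 = \<zeta> *s v1 - \<eta> *s v"
    unfolding v1_def mult_lie_br[of _ T v] using 0 by (simp_all add: vec.scale flip: Y_def Z_def)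
  have 2: "X *v v2 = x *s v2 - (2 * \<mu>) *s v1 + \<zeta> *s v"
    "Y *v v2 = \<mu> *s v2 - (2 * \<zeta>) *s v1 + \<eta> *s v"
    unfolding v2_def mult_lie_br[of _ T v1] Y_def[symmetric] Z_def[symmetric]
    unfolding 1 matrix_vector_mult_diff_distrib vec.scale v1_def[symmetric]
    by (simp_all add: vec_eq_iff algebra_simps)
  have 3: "X *v v3 = x *s v3 - (3 * \<mu>) *s v2 + (3 * \<zeta>) *s v1 - \<eta> *s v"
    unfolding v3_def mult_lie_br[of _ T v2] Y_def[symmetric]
    unfolding 2 matrix_vector_mult_diff_distrib vec.add vec.scale v1_def[symmetric] v2_def[symmetric]
    by (simp add: vec_eq_iff algebra_simps)
  define N where "N = X - cscale x (mat 1)"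
  have N_eq: "N *v w = X *v w - x *s w" for w
    by (simp add: N_def matrix_vector_mult_diff_rdistrib)
      (simp add: cscale_def mat_def matrix_vector_mult_def vec_eq_iff forall_3 sum_3)
  have N: "N *v v = 0" "N *v v1 = - \<mu> *s v" "N *v v2 = \<zeta> *s v - (2 * \<mu>) *s v1"
    "N *v v3 = (3 * \<zeta>) *s v1 - (3 * \<mu>) *s v2 - \<eta> *s v"
    unfolding N_eq 0 1 2 3 by (simp_all add: vec_eq_iff)
  obtain s1 s2 s3 where
    CH: "\<And>w. N *v (N *v (N *v w)) = s1 *s (N *v (N *v w)) + s2 *s (N *v w) + s3 *s w"
    using cayley_hamilton_3 by blast
  have N2: "N *v (N *v v1) = 0" "N *v (N *v v2) = (2 * \<mu> * \<mu>) *s v"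
    "N *v (N *v v3) = (6 * \<mu> * \<mu>) *s v1 - (6 * \<mu> * \<zeta>) *s v"
    unfolding N matrix_vector_mult_diff_distrib vec.scale by (simp_all add: vec_eq_iff algebra_simps)
  have N3: "N *v (N *v (N *v v3)) = (- 6 * \<mu> * \<mu> * \<mu>) *s v"
    unfolding N2 matrix_vector_mult_diff_distrib vec.scale N by (simp add: vec_eq_iff algebra_simps)
  \<comment> \<open>The relation is read at \<open>v\<close>, \<open>v1\<close>, \<open>v2\<close>,
    \<open>v3\<close> in turn. The first gives \<open>s3 = 0\<close>, the next two kill
    \<open>s2\<close> and \<open>s1\<close> unless \<mu> = 0, and the last leaves -6\<mu>^3 = 0. The
    terms with \<zeta> and \<eta> have dropped out by then.\<close>
  have "s3 = 0" using CH[of v] v unfolding N by simp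
  moreover have "s2 = 0 \<or> \<mu> = 0"
    using CH[of v1] v \<open>s3 = 0\<close> unfolding N2 unfolding N by simp
  moreover have "s1 = 0 \<or> \<mu> = 0" if "s2 = 0"
    using CH[of v2] v \<open>s3 = 0\<close> that unfolding N2 vec.scale unfolding N by simp
  moreover have "\<mu> = 0" if "s1 = 0" "s2 = 0"
    using CH[of v3] v \<open>s3 = 0\<close> that unfolding N3 by simp
  ultimately show ?thesis unfolding \<mu>_def Y_def by blast
qed

text \<open>The weight space of \<open>I\<close> for the weight of \<open>v\<close> is stable under
  \<open>T\<close>, because the weight vanishes on the brackets of \<open>T\<close> with
  \<open>I\<close>; so \<open>T\<close> has an eigenvector in it.\<close>

lemma common_eigenvector_extend:
  assumes V: "vec.subspace V" "\<And>w. w \<in> V \<Longrightarrow> T *v w \<in> V"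
    and ideal: "\<And>X. X \<in> I \<Longrightarrow> lie_br T X \<in> I"
    and v: "v \<in> V" "v \<noteq> 0" "\<And>X. X \<in> I \<Longrightarrow> \<exists>c. X *v v = c *s v"
  obtains v' where "v' \<in> V" "v' \<noteq> 0" "\<And>X. X \<in> insert T I \<Longrightarrow> \<exists>c. X *v v' = c *s (v' :: complex^3)"
proof -
  obtain l where l: "\<And>X. X \<in> I \<Longrightarrow> X *v v = l X *s v"
    using v(3) by metis
  define W where "W = {w \<in> V. \<forall>X\<in>I. X *v w = l X *s w}"
  have "vec.subspace W"
    using V(1) unfolding W_def vec.subspace_def
    by (auto simp: vec.add vec.scale vector_add_ldistrib mult.commute)
  moreover have "T *v w \<in> W" if "w \<in> W" for w
    using that V(2) weight_vanishes_on_bracket[of I T v l] ideal l v(2)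
    by (auto simp: W_def mult_lie_br[of _ T] vec.scale)
  moreover have "v \<in> W" using v l by (simp add: W_def)
  ultimately obtain v' c where "v' \<in> W" "v' \<noteq> 0" "T *v v' = c *s v'"
    using eigenvector_in_invariant_subspace[of W T v] v(2) by metis
  then show thesis by (intro that[of v']) (auto simp: W_def)
qed

definition ideal_chain :: "cmat3 \<Rightarrow> cmat3 \<Rightarrow> cmat3 \<Rightarrow> bool" where
  "ideal_chain C B T \<longleftrightarrow> (\<exists>k. lie_br B C = cscale k C) \<and>
     (\<exists>a b. lie_br T C = cscale a C + cscale b B) \<and> (\<exists>a b. lie_br T B = cscale a C + cscale b B)"

text \<open>The extension step climbs the chain: \<open>C\<close>, then \<open>B\<close> over the
  multiples of \<open>C\<close>, then \<open>T\<close> over the combinations of \<open>C\<close> and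
  \<open>B\<close>. The subspace \<open>V\<close> serves the second use of the lemma, where the
  eigenvector must lie in a given invariant plane.\<close>

lemma ideal_chain_eigenvector:
  assumes chain: "ideal_chain C B T"
    and V: "vec.subspace V" "\<And>X w. X \<in> {C, B, T} \<Longrightarrow> w \<in> V \<Longrightarrow> X *v w \<in> V" "v \<in> V" "v \<noteq> 0"
  obtains v' where "v' \<in> V" "v' \<noteq> 0"
    "\<And>X. X \<in> {C, B, T} \<Longrightarrow> \<exists>c. X *v v' = c *s (v' :: complex^3)"
proof -
  have inv: "C *v w \<in> V" "B *v w \<in> V" "T *v w \<in> V" if "w \<in> V" for w
    using V(2) that by blast+
  obtain u where u: "u \<in> V" "u \<noteq> 0" "\<And>X. X \<in> insert C {} \<Longrightarrow> \<exists>c. X *v u = c *s u"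
    by (rule common_eigenvector_extend[OF V(1) inv(1) _ V(3,4), of "{}"]) auto
  let ?I = "range (\<lambda>k. cscale k C)"
  have I: "lie_br B X \<in> ?I" if "X \<in> ?I" for X
    using that chain unfolding ideal_chain_def by (auto simp: lie_br_cscale_right)
  have I_eig: "\<exists>c. X *v u = c *s u" if "X \<in> ?I" for X
    using that u(3)[of C] by (auto simp: cscale_mult_vec)
  obtain u' where u': "u' \<in> V" "u' \<noteq> 0" "\<And>X. X \<in> insert B ?I \<Longrightarrow> \<exists>c. X *v u' = c *s u'"
    by (rule common_eigenvector_extend[OF V(1) inv(2) I u(1,2) I_eig]) auto
  have "C \<in> ?I" by (rule range_eqI[of _ _ 1]) simp
  then obtain c b where cb: "C *v u' = c *s u'" "B *v u' = b *s u'"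
    using u'(3)[of B] u'(3)[of C] by blast
  let ?J = "{cscale x C + cscale y B | x y. True}"
  have J: "lie_br T X \<in> ?J" if "X \<in> ?J" for X
  proof -
    obtain x y where X: "X = cscale x C + cscale y B" using \<open>X \<in> ?J\<close> by blast
    obtain p q r s where "lie_br T C = cscale p C + cscale q B" "lie_br T B = cscale r C + cscale s B"
      using chain unfolding ideal_chain_def by blast
    then have "lie_br T X = cscale (x * p + y * r) C + cscale (x * q + y * s) B"
      by (simp add: X lie_br_add_right lie_br_cscale_right algebra_simps)
    then show ?thesis by blast
  qed
  have J_eig: "\<exists>c. X *v u' = c *s u'" if "X \<in> ?J" for X
  proof -
    obtain x y where X: "X = cscale x C + cscale y B" using \<open>X \<in> ?J\<close> by blast
    have "X *v u' = (x * c + y * b) *s u'"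
      by (simp add: X matrix_vector_mult_add_rdistrib cscale_mult_vec cb vec_eq_iff algebra_simps)
    then show ?thesis by blast
  qed
  obtain w where w: "w \<in> V" "w \<noteq> 0" "\<And>X. X \<in> insert T ?J \<Longrightarrow> \<exists>c. X *v w = c *s w"
    by (rule common_eigenvector_extend[OF V(1) inv(3) J u'(1,2) J_eig]) auto
  have "C = cscale 1 C + cscale 0 B" "B = cscale 0 C + cscale 1 B" by simp_all
  then have "C \<in> ?J" "B \<in> ?J" by blast+
  then show thesis using w by (intro that[of w]) auto
qed

text \<open>Transposition reverses products, so it only changes the signs of the
  coefficients.\<close>

lemma ideal_chain_transpose:
  assumes "ideal_chain C B T" shows "ideal_chain (transpose C) (transpose B) (transpose T)"
proof -
  have br: "lie_br (transpose X) (transpose Y) = cscale (- 1) (transpose (lie_br X Y))" for X Y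
    by (cases X rule: m3_cases; cases Y rule: m3_cases) (simp add: lie_br_def algebra_simps)
  have tr: "transpose (cscale a X + cscale b Y) = cscale a (transpose X) + cscale b (transpose Y)"
    for a b X Y
    by (cases X rule: m3_cases; cases Y rule: m3_cases) simp
  obtain k a b c d where chain: "lie_br B C = cscale k C" "lie_br T C = cscale a C + cscale b B"
    "lie_br T B = cscale c C + cscale d B"
    using assms unfolding ideal_chain_def by blast
  have "lie_br (transpose B) (transpose C) = cscale (- k) (transpose C)"
    using tr[of k C 0 C] by (simp add: br chain)
  moreover have "lie_br (transpose T) (transpose C) = cscale (- a) (transpose C) + cscale (- b) (transpose B)"
    "lie_br (transpose T) (transpose B) = cscale (- c) (transpose C) + cscale (- d) (transpose B)"
    by (simp_all add: br chain tr)
  ultimately show ?thesis unfolding ideal_chain_def by blast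
qed

text \<open>The derived algebra \<open>D\<close> is proper, since otherwise the derived series would
  be constant. Any plane between \<open>D\<close> and \<open>S\<close> is an ideal, and a
  2-dimensional Lie algebra always contains an ideal line.\<close>

lemma solvable_ideal_chain:
  assumes S: "lie_subalgebra S" "cmat.dim S = 3" "solvable S"
  obtains C B T where "ideal_chain C B T" "S = cmat.span {C, B, T}"
proof -
  define D where "D = cmat.span {lie_br X Y | X Y. X \<in> S \<and> Y \<in> S}"
  have sub: "cmat.subspace S" using S(1) by (simp add: lie_subalgebra_def)
  have DS: "D \<subseteq> S"
    unfolding D_def using S(1) by (intro cmat.span_minimal) (auto simp: lie_subalgebra_def)
  have "D \<noteq> S"
  proof
    assume "D = S"
    then have "derived_series S n = S" for n
      by (induction n) (simp_all add: D_def)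
    then have "S = {0}" using S(3) by (simp add: solvable_def)
    then show False using S(2) by simp
  qed
  obtain BD where BD: "BD \<subseteq> D" "cmat.independent BD" "D \<subseteq> cmat.span BD"
    using cmat.maximal_independent_subset by blast
  obtain BS where BS: "BD \<subseteq> BS" "BS \<subseteq> S" "cmat.independent BS" "S \<subseteq> cmat.span BS"
    using cmat.maximal_independent_subset_extend[OF _ BD(2), of S] BD(1) DS by blast
  have card: "card BS = 3"
    using BS S(2) cmat.basis_card_eq_dim by metis
  have "BD \<noteq> BS"
  proof
    assume "BD = BS"
    then have "S \<subseteq> D"
      using BS(4) BD(1) cmat.span_minimal[of BD D] cmat.subspace_span D_def by blast
    then show False using DS \<open>D \<noteq> S\<close> by blast
  qed
  \<comment> \<open>Dropping a basis element outside \<open>BD\<close> leaves two elements whose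
    span still contains \<open>D\<close>.\<close>
  then obtain T where T: "T \<in> BS" "T \<notin> BD" using BS(1) by blast
  then have "card (BS - {T}) = 2" using card by simp
  then obtain A E where AE: "BS - {T} = {A, E}" by (auto simp: card_2_iff)
  have D: "D \<subseteq> cmat.span {A, E}"
    using BD(3) BS(1) T AE cmat.span_mono[of BD "{A, E}"] by blast
  have "BS = {A, E, T}" using AE T by blast
  then have S_eq: "S = cmat.span {A, E, T}"
    using BS cmat.span_minimal[OF BS(2) sub] by blast
  have span2: "\<exists>a e. X = cscale a A + cscale e E" if "X \<in> cmat.span {A, E}" for X
  proof -
    obtain a where "X - cscale a A \<in> cmat.span {E}"
      using \<open>X \<in> cmat.span {A, E}\<close> by (auto simp: cmat.span_breakdown_eq)
    then obtain e where "X - cscale a A - cscale e E = 0"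
      by (auto simp: cmat.span_breakdown_eq)
    then have "X = cscale a A + cscale e E" by (simp add: algebra_simps)
    then show ?thesis by blast
  qed
  have mem: "A \<in> S" "E \<in> S" "T \<in> S" using BS(2) \<open>BS = {A, E, T}\<close> by blast+
  have br: "\<exists>a e. lie_br X Y = cscale a A + cscale e E" if "X \<in> S" "Y \<in> S" for X Y
  proof -
    have "lie_br X Y \<in> D" unfolding D_def using that by (intro cmat.span_base) blast
    then show ?thesis using D span2 by blast
  qed
  obtain a e where AE_br: "lie_br A E = cscale a A + cscale e E" using br mem by blast
  show thesis
  \<comment> \<open>The ideal line in the plane of \<open>A\<close> and \<open>E\<close> is spanned
    by \<open>E\<close> if the bracket is a multiple of \<open>E\<close>, and otherwise by the
    bracket itself.\<close>
  proof (cases "a = 0")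
    case True
    then have "lie_br A E = cscale e E" by (simp add: AE_br)
    moreover have "\<exists>p q. lie_br T X = cscale p E + cscale q A" if "X \<in> S" for X
      using br[OF mem(3) that] by (metis add.commute)
    ultimately have "ideal_chain E A T" unfolding ideal_chain_def using mem by blast
    then show thesis using S_eq by (intro that[of E A T]) (simp_all add: insert_commute)
  next
    case False
    let ?C = "cscale a A + cscale e E"
    have A: "A = cscale (1 / a) ?C + cscale (- (e / a)) E"
      using False by (simp add: cmat.scale_right_distrib)
    have "lie_br E ?C = cscale (- a) ?C"
      unfolding lie_br_add_right lie_br_cscale_right lie_br_self lie_br_commute[of E A] AE_br
      by (simp add: cmat.scale_right_distrib cmat.scale_right_diff_distrib)
    moreover have "\<exists>p q. lie_br T X = cscale p ?C + cscale q E" if "X \<in> S" for X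
    proof -
      obtain p q where "lie_br T X = cscale p A + cscale q E" using br[OF mem(3) \<open>X \<in> S\<close>] by blast
      also have "cscale p A = cscale (p / a) ?C + cscale (- (p * e / a)) E"
        by (subst A) (simp add: cmat.scale_right_distrib False)
      finally have "lie_br T X = cscale (p / a) ?C + cscale (q - p * e / a) E"
        by (simp add: algebra_simps)
      then show ?thesis by blast
    qed
    moreover have "?C \<in> S"
      using sub mem by (intro cmat.subspace_add cmat.subspace_scale)
    ultimately have "ideal_chain ?C E T" unfolding ideal_chain_def using mem by blast
    moreover have "S = cmat.span {?C, E, T}"
    proof
      have "A \<in> cmat.span {?C, E, T}"
        by (subst A) (intro cmat.span_add cmat.span_scale cmat.span_base; simp)
      then show "S \<subseteq> cmat.span {?C, E, T}"
        unfolding S_eq by (intro cmat.span_minimal cmat.subspace_span) (auto intro: cmat.span_base)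
      show "cmat.span {?C, E, T} \<subseteq> S"
        using \<open>?C \<in> S\<close> mem by (intro cmat.span_minimal sub) blast
    qed
    ultimately show thesis by (rule that)
  qed
qed

section \<open>From common eigenvectors to an invariant flag\<close>

lemma span_eigenvector:
  assumes "\<And>X. X \<in> W \<Longrightarrow> \<exists>c. X *v v = c *s v" "X \<in> cmat.span W"
  shows "\<exists>c. X *v v = c *s (v :: complex^3)"
proof -
  have "cmat.subspace {X. \<exists>c. X *v v = c *s v}"
  proof (rule cmat.subspaceI; unfold mem_Collect_eq)
    show "\<exists>c. 0 *v v = c *s v" by (intro exI[of _ 0]) simp
    show "\<exists>c. (X + Y) *v v = c *s v" if "\<exists>c. X *v v = c *s v" "\<exists>c. Y *v v = c *s v" for X Y
      using that by (metis matrix_vector_mult_add_rdistrib vector_sadd_rdistrib)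
    show "\<exists>c. cscale k X *v v = c *s v" if "\<exists>c. X *v v = c *s v" for k X
      using that by (metis cscale_mult_vec vector_smult_assoc)
  qed
  then have "cmat.span W \<subseteq> {X. \<exists>c. X *v v = c *s v}"
    using assms(1) by (intro cmat.span_minimal) blast+
  then show ?thesis using assms(2) by blast
qed

text \<open>The columns of \<open>P\<close> are \<open>v\<close>, a second vector \<open>w\<close>
  of the plane f = 0, and a vector \<open>u\<close> outside that plane. In this basis the flag of
  the line of \<open>v\<close> inside the plane is the standard one.\<close>

lemma flag_basis:
  fixes f v :: "complex^3"
  assumes "f \<noteq> 0" "v \<noteq> 0" and fv: "f$1 * v$1 + f$2 * v$2 + f$3 * v$3 = 0"
  obtains P where "det P \<noteq> 0" "P *v axis 1 1 = v" "\<exists>k. k \<noteq> 0 \<and> transpose P *v f = k *s axis 3 1"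
proof -
  define P where "P w u = m3 (v$1) (w$1) (u$1) (v$2) (w$2) (u$2) (v$3) (w$3) (u$3)"
    for w u :: "complex^3"
  have P: "P w u *v axis 1 1 = v" for w u
    by (simp add: P_def vec_eq_iff forall_3 matrix_vector_mult_def sum_3 axis_def)
  note result = that
  have goal: thesis if "det (P w u) \<noteq> 0" "f$1 * w$1 + f$2 * w$2 + f$3 * w$3 = 0"
    "f$1 * u$1 + f$2 * u$2 + f$3 * u$3 \<noteq> 0" for w u
  proof (rule result[OF _ P])
    show "det (P w u) \<noteq> 0" by fact
    have "transpose (P w u) *v f = (f$1 * u$1 + f$2 * u$2 + f$3 * u$3) *s axis 3 1"
      using that(2) fv
      by (simp add: P_def vec_eq_iff forall_3 matrix_vector_mult_def sum_3 axis_def algebra_simps)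
    then show "\<exists>k. k \<noteq> 0 \<and> transpose (P w u) *v f = k *s axis 3 1" using that(3) by blast
  qed
  have *: "v$1 \<noteq> 0 \<or> v$2 \<noteq> 0 \<or> v$3 \<noteq> 0" "f$1 \<noteq> 0 \<or> f$2 \<noteq> 0 \<or> f$3 \<noteq> 0"
    using assms by (auto simp: vec_eq_iff forall_3)
  define e :: "complex \<Rightarrow> complex \<Rightarrow> complex \<Rightarrow> complex^3" where "e a b c = vector [a, b, c]" for a b c
  have e: "e a b c $ 1 = a" "e a b c $ 2 = b" "e a b c $ 3 = c" for a b c by (simp_all add: e_def)
  \<comment> \<open>There are distinct i and j with f_i and v_j nonzero: otherwise \<open>f\<close>
    and \<open>v\<close> would be supported at one common index and could not pair to 0. Then
    \<open>u\<close> is the i-th unit vector, and \<open>w\<close> lives in coordinates i and the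
    one besides i and j.\<close>
  consider "f$1 \<noteq> 0" "v$2 \<noteq> 0" | "f$1 \<noteq> 0" "v$3 \<noteq> 0" | "f$2 \<noteq> 0" "v$1 \<noteq> 0" | "f$2 \<noteq> 0" "v$3 \<noteq> 0"
    | "f$3 \<noteq> 0" "v$1 \<noteq> 0" | "f$3 \<noteq> 0" "v$2 \<noteq> 0"
    using * fv by fastforce
  then show thesis
  proof cases
    case 1 then show ?thesis by (intro goal[of "e (f$3) 0 (- f$1)" "e 1 0 0"]) (simp_all add: P_def e)
  next
    case 2 then show ?thesis by (intro goal[of "e (f$2) (- f$1) 0" "e 1 0 0"]) (simp_all add: P_def e)
  next
    case 3 then show ?thesis by (intro goal[of "e 0 (f$3) (- f$2)" "e 0 1 0"]) (simp_all add: P_def e)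
  next
    case 4 then show ?thesis by (intro goal[of "e (f$2) (- f$1) 0" "e 0 1 0"]) (simp_all add: P_def e)
  next
    case 5 then show ?thesis by (intro goal[of "e 0 (f$3) (- f$2)" "e 0 0 1"]) (simp_all add: P_def e)
  next
    case 6 then show ?thesis by (intro goal[of "e (f$3) 0 (- f$1)" "e 0 0 1"]) (simp_all add: P_def e)
  qed
qed

definition upper_triangular3 :: "cmat3 \<Rightarrow> bool" where
  "upper_triangular3 X \<longleftrightarrow> X$2$1 = 0 \<and> X$3$1 = 0 \<and> X$3$2 = 0"

text \<open>A common eigenvector \<open>f\<close> of the transposes is a functional whose kernel is
  an invariant plane; a common eigenvector inside that plane completes the flag.\<close>

lemma solvable_triangularizable:
  assumes S: "lie_subalgebra S" "cmat.dim S = 3" "solvable S"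
  obtains S' where "equivalent S S'" "lie_subalgebra S'" "cmat.dim S' = 3"
    "\<And>X. X \<in> S' \<Longrightarrow> upper_triangular3 X"
proof -
  obtain C B T where chain: "ideal_chain C B T" and S_eq: "S = cmat.span {C, B, T}"
    using solvable_ideal_chain[OF S] by blast
  obtain f where f: "f \<noteq> 0"
    "\<And>X. X \<in> {transpose C, transpose B, transpose T} \<Longrightarrow> \<exists>c. X *v f = c *s (f :: complex^3)"
  proof (rule ideal_chain_eigenvector[OF ideal_chain_transpose[OF chain], of UNIV "axis 1 1"])
    show "(axis 1 1 :: complex^3) \<noteq> 0" by (simp add: axis_eq_0_iff)
  qed (use that in auto)
  define pair where "pair w = f$1 * w$1 + f$2 * w$2 + f$3 * w$3" for w :: "complex^3"
  let ?V = "{w. pair w = 0}"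
  have pair_mult: "pair (X *v w) = c * pair w" if "transpose X *v f = c *s f" for X w c
  proof -
    have "(transpose X *v f) $ i = c * f $ i" for i using that by simp
    note eqs = this[of 1] this[of 2] this[of 3]
    have "pair (X *v w) = (transpose X *v f)$1 * w$1 + (transpose X *v f)$2 * w$2 + (transpose X *v f)$3 * w$3"
      by (simp add: pair_def matrix_vector_mult_def sum_3 transpose_def algebra_simps)
    then show ?thesis unfolding eqs by (simp add: pair_def algebra_simps)
  qed
  have V_sub: "vec.subspace ?V"
    by (auto simp: vec.subspace_def pair_def algebra_simps) algebra+
  have V_inv: "X *v w \<in> ?V" if "X \<in> {C, B, T}" "w \<in> ?V" for X w
    using f(2)[of "transpose X"] that pair_mult by fastforce
  obtain w0 where w0: "w0 \<in> ?V" "w0 \<noteq> 0"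
  proof (cases "f$1 = 0")
    case True
    then show thesis by (intro that[of "axis 1 1"]) (simp_all add: pair_def axis_def axis_eq_0_iff vec_eq_iff)
  next
    case False
    then show thesis
      by (intro that[of "vector [- f$2, f$1, 0]"]) (auto simp: pair_def vec_eq_iff forall_3)
  qed
  have "\<exists>v. v \<in> ?V \<and> v \<noteq> 0 \<and> (\<forall>X\<in>{C, B, T}. \<exists>c. X *v v = c *s v)"
    by (rule ideal_chain_eigenvector[OF chain V_sub V_inv w0]) blast+
  then obtain v where v: "v \<in> ?V" "v \<noteq> 0" "\<And>X. X \<in> {C, B, T} \<Longrightarrow> \<exists>c. X *v v = c *s v"
    by blast
  have "f$1 * v$1 + f$2 * v$2 + f$3 * v$3 = 0"
    using v(1) by (simp add: pair_def)
  then obtain P where P: "det P \<noteq> 0" "P *v axis 1 1 = v"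
    and "\<exists>k. k \<noteq> 0 \<and> transpose P *v f = k *s axis 3 1"
    by (rule flag_basis[OF f(1) v(2)])
  then obtain k where k: "k \<noteq> 0" "transpose P *v f = k *s axis 3 1" by blast
  obtain Q where PQ: "P ** Q = mat 1" "Q ** P = mat 1"
    using P(1) invertible_det_nz[of P] invertible_def by blast
  let ?S = "(\<lambda>A. Q ** A ** P) ` S"
  have "upper_triangular3 (Q ** X ** P)" if X: "X \<in> cmat.span {C, B, T}" for X
  proof -
    obtain c where c: "X *v v = c *s v"
      using span_eigenvector[OF v(3) X] by blast
    have "transpose X \<in> cmat.span {transpose C, transpose B, transpose T}"
    proof -
      obtain a b d where "X = cscale a C + cscale b B + cscale d T"
        using X unfolding span_triple_iff by blast
      then have "transpose X = cscale a (transpose C) + cscale b (transpose B) + cscale d (transpose T)"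
        by (cases C rule: m3_cases; cases B rule: m3_cases; cases T rule: m3_cases) simp
      then show ?thesis unfolding span_triple_iff by blast
    qed
    then obtain d where d: "transpose X *v f = d *s f"
      using span_eigenvector[OF f(2)] by blast
    have QP: "(transpose P ** transpose Q) = mat 1" "transpose Q ** transpose P = mat 1"
      using PQ by (simp_all add: matrix_transpose_mul[symmetric] transpose_mat)
    have e1: "(Q ** X ** P) *v axis 1 1 = c *s axis 1 1"
    proof -
      have "(Q ** X ** P) *v axis 1 1 = Q *v (X *v (P *v axis 1 1))"
        by (simp add: matrix_vector_mul_assoc matrix_mul_assoc)
      also have "\<dots> = c *s ((Q ** P) *v axis 1 1)"
        by (simp add: P(2) c vec.scale flip: matrix_vector_mul_assoc)
      finally show ?thesis by (simp add: PQ)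
    qed
    have e3: "transpose (Q ** X ** P) *v axis 3 1 = d *s axis 3 1"
    proof -
      have f_eq: "f = k *s (transpose Q *v axis 3 1)"
        using k(2) QP(2) by (metis matrix_vector_mul_assoc matrix_vector_mul_lid vec.scale)
      have "k *s (transpose (Q ** X ** P) *v axis 3 1) = transpose P *v (transpose X *v f)"
        unfolding f_eq matrix_transpose_mul vec.scale
        by (simp only: matrix_vector_mul_assoc matrix_mul_assoc)
      also have "\<dots> = k *s (d *s axis 3 1)"
        unfolding d vec.scale k(2) by (simp only: vector_smult_assoc mult.commute)
      finally show ?thesis using k(1) by (simp only: vec.scale_cancel_left) simp
    qed
    have entry: "(A *v axis i 1) $ j = A $ j $ i" for A :: cmat3 and i j
      by (simp add: matrix_vector_mult_def axis_def if_distrib[of "\<lambda>x. _ * x"] cong: if_cong)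
    show ?thesis
      \<comment> \<open>The eigenvector gives the zeros of the first column, the functional those of
        the last row.\<close>
      using arg_cong[OF e1, of "\<lambda>w. w $ 2"] arg_cong[OF e1, of "\<lambda>w. w $ 3"]
        arg_cong[OF e3, of "\<lambda>w. w $ 2"]
      unfolding entry upper_triangular3_def by (simp add: axis_def transpose_def)
  qed
  note triangular = this
  show thesis
  proof (rule that[of ?S])
    show "equivalent S ?S" unfolding equivalent_iff using PQ by blast
    show "lie_subalgebra ?S" by (rule lie_subalgebra_conj[OF S(1) PQ(1)])
    show "cmat.dim ?S = 3" using S(2) dim_conj[OF PQ(1)] by simp
    show "upper_triangular3 X" if "X \<in> ?S" for X
      using that triangular unfolding S_eq by blast
  qed
qed

section \<open>Triangular subalgebras\<close>

lemma equivalent_listedI: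
  assumes S: "lie_subalgebra S" "cmat.dim S = 3" and l: "admissible l" "listed_generators l = (X, Y, Z)"
    and PQ: "P ** Q = mat 1" and mem: "P ** X ** Q \<in> S" "P ** Y ** Q \<in> S" "P ** Z ** Q \<in> S"
  shows "equivalent S (listed l)"
  unfolding listed_eq[OF l(2)]
  by (rule equivalent_generatedI[OF S _ _ PQ])
    (use listed_correct[OF l(1)] listed_eq[OF l(2)] mem in auto)

lemma ex_equivalent_listedI:
  assumes "lie_subalgebra S" "cmat.dim S = 3" "admissible l" "listed_generators l = (X, Y, Z)"
    "P ** Q = mat 1" "P ** X ** Q \<in> S" "P ** Y ** Q \<in> S" "P ** Z ** Q \<in> S"
  shows "\<exists>l. admissible l \<and> equivalent S (listed l)"
  using equivalent_listedI[OF assms] assms(3) by blast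

lemma subspace_comb:
  assumes "cmat.subspace S" "A \<in> S" "B \<in> S" "X = cscale a A + cscale b B"
  shows "X \<in> S"
  using assms by (simp add: cmat.subspace_add cmat.subspace_scale)

context
  fixes S
  assumes S: "lie_subalgebra S" "cmat.dim S = 3"
begin

lemma S_subspace: "cmat.subspace S" and S_lie_br: "A \<in> S \<Longrightarrow> B \<in> S \<Longrightarrow> lie_br A B \<in> S"
  using S(1) by (simp_all add: lie_subalgebra_def)

lemma classify_strictly_upper:
  assumes "m3 0 1 0 0 0 0 0 0 0 \<in> S" "m3 0 0 0 0 0 1 0 0 0 \<in> S"
  shows "\<exists>l. admissible l \<and> equivalent S (listed l)"
proof (rule ex_equivalent_listedI[OF S, of L5_1 x1 x2 x3 "mat 1" "mat 1"])
  have "m3 0 0 1 0 0 0 0 0 0 \<in> S"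
    using S_lie_br[OF assms] by (simp add: lie_br_def)
  then show "mat 1 ** x3 ** mat 1 \<in> S"
    by (simp add: generators_m3 subspace_comb[OF S_subspace, of _ 0 _ "- 1"] cmat.subspace_0[OF S_subspace])
qed (use assms in \<open>simp_all add: generators_m3\<close>)

text \<open>Given E12 and E13, only the lower right block of \<open>T\<close> matters. If its
  eigenvalues coincide it is scalar or a Jordan block, giving the types \<open>L2\<close> and
  \<open>L3 (- (1 / 4))\<close>; otherwise it is diagonalized.\<close>

lemma classify_row:
  assumes E: "m3 0 1 0 0 0 0 0 0 0 \<in> S" "m3 0 0 1 0 0 0 0 0 0 \<in> S"
    and T: "m3 t1 0 0 0 t2 q 0 0 t3 \<in> S" and t3: "t3 = - t1 - t2" and nz: "t1 \<noteq> 0 \<or> t2 \<noteq> 0"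
  shows "\<exists>l. admissible l \<and> equivalent S (listed l)"
proof -
  have mem: "m3 a x y 0 b z 0 0 w \<in> S" if "a = c * t1" "b = c * t2" "z = c * q" "w = c * t3"
    for a b c x y z w
  proof -
    have "cscale x (m3 0 1 0 0 0 0 0 0 0) + cscale y (m3 0 0 1 0 0 0 0 0 0) +
        cscale c (m3 t1 0 0 0 t2 q 0 0 t3) \<in> S"
      using E T by (intro cmat.subspace_add[OF S_subspace] cmat.subspace_scale[OF S_subspace])
    then show ?thesis by (simp add: that)
  qed
  show ?thesis
  proof (cases "t2 = t3")
    case True
    have "t1 = - t3 - t2" by (simp add: t3)
    then have t1: "t1 = - 2 * t2" by (simp flip: True)
    with True nz have t: "t1 = - 2 * t2" "t3 = t2" "t2 \<noteq> 0" by auto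
    show ?thesis
    proof (cases "q = 0")
      case True
      show ?thesis
      proof (rule ex_equivalent_listedI[OF S, of L2_1 x1 x3 "cscale 2 h1 + h2" "mat 1" "mat 1"])
        show "mat 1 ** (cscale 2 h1 + h2) ** mat 1 \<in> S"
          using t True by (simp add: generators_m3) (rule mem[of _ "- 1 / t2"], auto)
      qed (simp_all add: generators_m3 mem[of _ 0])
    next
      case False
      \<comment> \<open>Conjugation by diag(1, s, 1) scales E23 by \<open>s\<close>, which matches
        the corner entry of \<open>T / (- t2)\<close>.\<close>
      define s where "s = - q / t2"
      have s: "s \<noteq> 0" using False t by (simp add: s_def)
      show ?thesis
      proof (rule ex_equivalent_listedI[OF S, of L3_quarter_1 x1 x3 "cscale 2 h1 + h2 + x2"
            "m3 1 0 0 0 s 0 0 0 1" "m3 1 0 0 0 (1 / s) 0 0 0 1"])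
        show "m3 1 0 0 0 s 0 0 0 1 ** (cscale 2 h1 + h2 + x2) ** m3 1 0 0 0 (1 / s) 0 0 0 1 \<in> S"
          using t s by (simp add: generators_m3) (rule mem[of _ "- 1 / t2"], auto simp: s_def)
      qed (use s in \<open>simp_all add: generators_m3 m3_one mem[of _ 0]\<close>)
    qed
  next
    case False
    define u where "u = q / (t3 - t2)"
    have u: "u * (t3 - t2) = q" using False by (simp add: u_def)
    show ?thesis
    proof (cases "t2 = 0")
      case True
      then have t: "t2 = 0" "t1 = - t3" "t3 \<noteq> 0" "u * t3 = q" using t3 nz u by auto
      \<comment> \<open>Here \<open>T\<close> cannot be scaled to middle entry 1. Exchanging the
        last two coordinates moves the zero to the last place, which is the member \<alpha> =
        0.\<close>
      show ?thesis
      proof (rule ex_equivalent_listedI[OF S, of "L3_family_1 0" x1 x3 "cscale (0 - 1) h1 + cscale 0 h2"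
            "m3 1 0 0 0 u 1 0 1 0" "m3 1 0 0 0 0 1 0 1 (- u)"])
        show "m3 1 0 0 0 u 1 0 1 0 ** (cscale (0 - 1) h1 + cscale 0 h2) ** m3 1 0 0 0 0 1 0 1 (- u) \<in> S"
          using t by (simp add: generators_m3) (rule mem[of _ "1 / t3"], auto simp: field_simps)
      qed (simp_all add: generators_m3 m3_one mem[of _ 0])
    next
      case t2: False
      \<comment> \<open>Read off from \<open>T / t2\<close> with diagonal (\<alpha> - 1, 1,
        -\<alpha>). The case \<alpha> = -1 would mean \<open>t2 = t3\<close>, and \<alpha> = 1 makes
        the third generator \<open>h2\<close>, that is \<open>L4_1\<close>.\<close>
      define \<alpha> where "\<alpha> = - t3 / t2"
      have \<alpha>: "t3 = - \<alpha> * t2" "t1 = (\<alpha> - 1) * t2" "\<alpha> \<noteq> -1"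
      proof -
        show "t3 = - \<alpha> * t2" using t2 by (simp add: \<alpha>_def)
        then show "t1 = (\<alpha> - 1) * t2" using t3 by algebra
        show "\<alpha> \<noteq> -1" using False t2 by (auto simp: \<alpha>_def field_simps)
      qed
      have "q = u * (- \<alpha> * t2 - t2)" using u \<alpha>(1) by metis
      also have "\<dots> = - u * (\<alpha> + 1) * t2" by (simp add: algebra_simps)
      finally have q: "q = - u * (\<alpha> + 1) * t2" .
      let ?Z = "cscale (\<alpha> - 1) h1 + cscale \<alpha> h2"
      let ?l = "if \<alpha> = 1 then L4_1 else L3_family_1 \<alpha>"
      show ?thesis
      proof (rule ex_equivalent_listedI[OF S, of ?l x1 x3 ?Z
            "m3 1 0 0 0 1 u 0 0 1" "m3 1 0 0 0 1 (- u) 0 0 1"])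
        show "m3 1 0 0 0 1 u 0 0 1 ** ?Z ** m3 1 0 0 0 1 (- u) 0 0 1 \<in> S"
          using t2 by (simp add: generators_m3)
            (rule mem[of _ "1 / t2"], simp_all add: \<alpha> q field_simps)
      qed (use \<alpha>(3) in \<open>simp_all add: generators_m3 m3_one mem[of _ 0]\<close>)
    qed
  qed
qed

text \<open>The mirror image of the row case, with the upper left block of \<open>T\<close>. The
  listed representatives keep their nilpotents in column 2 or column 1, so each conjugating matrix
  also moves that column to the third place.\<close>

lemma classify_column:
  assumes E: "m3 0 0 0 0 0 1 0 0 0 \<in> S" "m3 0 0 1 0 0 0 0 0 0 \<in> S"
    and T: "m3 t1 p 0 0 t2 0 0 0 t3 \<in> S" and t3: "t3 = - t1 - t2" and nz: "t1 \<noteq> 0 \<or> t2 \<noteq> 0"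
  shows "\<exists>l. admissible l \<and> equivalent S (listed l)"
proof -
  have mem: "m3 a x y 0 b z 0 0 w \<in> S" if "a = c * t1" "b = c * t2" "x = c * p" "w = c * t3"
    for a b c x y z w
  proof -
    have "cscale z (m3 0 0 0 0 0 1 0 0 0) + cscale y (m3 0 0 1 0 0 0 0 0 0) +
        cscale c (m3 t1 p 0 0 t2 0 0 0 t3) \<in> S"
      using E T by (intro cmat.subspace_add[OF S_subspace] cmat.subspace_scale[OF S_subspace])
    then show ?thesis by (simp add: that)
  qed
  show ?thesis
  proof (cases "t1 = t2")
    case True
    then have t: "t3 = - 2 * t1" "t2 = t1" "t1 \<noteq> 0" using t3 nz by auto
    show ?thesis
    proof (cases "p = 0")
      case True
      show ?thesis
      proof (rule ex_equivalent_listedI[OF S, of L2_2 x1 y2 "h1 - h2"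
            "m3 1 0 0 0 0 1 0 1 0" "m3 1 0 0 0 0 1 0 1 0"])
        show "m3 1 0 0 0 0 1 0 1 0 ** (h1 - h2) ** m3 1 0 0 0 0 1 0 1 0 \<in> S"
          using t True by (simp add: generators_m3) (rule mem[of _ "1 / t1"], auto)
      qed (simp_all add: generators_m3 m3_one mem[of _ 0])
    next
      case False
      define s where "s = - p / t1"
      have s: "s \<noteq> 0" using False t by (simp add: s_def)
      show ?thesis
      proof (rule ex_equivalent_listedI[OF S, of L3_quarter_2 y1 y3 "cscale 2 h1 + h2 + x2"
            "m3 0 s 0 0 0 1 1 0 0" "m3 0 0 1 (1 / s) 0 0 0 1 0"])
        show "m3 0 s 0 0 0 1 1 0 0 ** (cscale 2 h1 + h2 + x2) ** m3 0 0 1 (1 / s) 0 0 0 1 0 \<in> S"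
          using t s by (simp add: generators_m3) (rule mem[of _ "- 1 / t1"], auto simp: s_def)
      qed (use s in \<open>simp_all add: generators_m3 m3_one mem[of _ 0]\<close>)
    qed
  next
    case False
    define u where "u = p / (t2 - t1)"
    have u: "u * (t2 - t1) = p" using False by (simp add: u_def)
    show ?thesis
    proof (cases "t1 = 0")
      case True
      then have t: "t1 = 0" "t3 = - t2" "t2 \<noteq> 0" "u * t2 = p" using t3 nz u by auto
      show ?thesis
      proof (rule ex_equivalent_listedI[OF S, of "L3_family_2 0" x1 y2 "h1 + cscale 0 h2"
            "m3 u 0 1 1 0 0 0 1 0" "m3 0 1 0 0 0 1 1 (- u) 0"])
        show "m3 u 0 1 1 0 0 0 1 0 ** (h1 + cscale 0 h2) ** m3 0 1 0 0 0 1 1 (- u) 0 \<in> S"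
          using t by (simp add: generators_m3) (rule mem[of _ "1 / t2"], auto simp: field_simps)
      qed (simp_all add: generators_m3 m3_one mem[of _ 0])
    next
      case t1: False
      define \<alpha> where "\<alpha> = - t2 / t1"
      have \<alpha>: "t2 = - \<alpha> * t1" "t3 = (\<alpha> - 1) * t1" "\<alpha> \<noteq> -1"
      proof -
        show "t2 = - \<alpha> * t1" using t1 by (simp add: \<alpha>_def)
        then show "t3 = (\<alpha> - 1) * t1" using t3 by algebra
        show "\<alpha> \<noteq> -1" using False t1 by (auto simp: \<alpha>_def field_simps)
      qed
      have "p = u * (- \<alpha> * t1 - t1)" using u \<alpha>(1) by metis
      also have "\<dots> = - u * (\<alpha> + 1) * t1" by (simp add: algebra_simps)
      finally have p: "p = - u * (\<alpha> + 1) * t1" .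
      let ?Z = "h1 + cscale \<alpha> h2"
      let ?l = "if \<alpha> = 1 then L4_2 else L3_family_2 \<alpha>"
      show ?thesis
      proof (rule ex_equivalent_listedI[OF S, of ?l x1 y2 ?Z
            "m3 1 0 u 0 0 1 0 1 0" "m3 1 (- u) 0 0 0 1 0 1 0"])
        show "m3 1 0 u 0 0 1 0 1 0 ** ?Z ** m3 1 (- u) 0 0 0 1 0 1 0 \<in> S"
          using t1 by (simp add: generators_m3)
            (rule mem[of _ "1 / t1"], simp_all add: \<alpha> p field_simps)
      qed (use \<alpha>(3) in \<open>simp_all add: generators_m3 m3_one mem[of _ 0]\<close>)
    qed
  qed
qed

text \<open>Modulo E13, bracketing with \<open>T\<close> multiplies the E12 and E23 parts of the
  second generator by \<open>t1 - t2\<close> and \<open>t2 - t3\<close>, whose difference is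
  \<open>- 3 * t2\<close>. Hence either \<open>t2 = 0\<close>, or both parts lie in \<open>S\<close>
  separately.\<close>

lemma classify_principal:
  assumes E: "m3 0 0 1 0 0 0 0 0 0 \<in> S" and Z: "m3 0 a 0 0 0 b 0 0 0 \<in> S" "a \<noteq> 0" "b \<noteq> 0"
    and T: "m3 t1 p 0 0 t2 q 0 0 t3 \<in> S" and t3: "t3 = - t1 - t2" and nz: "t1 \<noteq> 0 \<or> t2 \<noteq> 0"
  shows "\<exists>l. admissible l \<and> equivalent S (listed l)"
proof (cases "t2 = 0")
  case False
  have "lie_br (m3 t1 p 0 0 t2 q 0 0 t3) (m3 0 a 0 0 0 b 0 0 0) \<in> S" using T Z by (intro S_lie_br)
  then have V: "m3 0 ((t1 - t2) * a) (p * b - a * q) 0 0 ((t2 - t3) * b) 0 0 0 \<in> S" (is "?V \<in> S")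
    by (simp add: lie_br_def algebra_simps)
  have comb: "cscale x ?V + cscale y (m3 0 a 0 0 0 b 0 0 0) + cscale z (m3 0 0 1 0 0 0 0 0 0) \<in> S" for x y z
    using V Z E by (intro cmat.subspace_add[OF S_subspace] cmat.subspace_scale[OF S_subspace])
  let ?d = "- 3 * t2"
  have d: "t1 - t2 - (t2 - t3) = ?d" by (simp add: t3)
  \<comment> \<open>This case is vacuous, since E12, E23, E13 and \<open>T\<close> would be four
    independent elements; the strictly upper triangular case covers it without that
    contradiction.\<close>
  show ?thesis
  proof (rule classify_strictly_upper)
    have "m3 0 (a * ?d) 0 0 0 0 0 0 0 \<in> S"
      using comb[of 1 "- (t2 - t3)" "- (p * b - a * q)"] by (simp add: algebra_simps t3)
    then have "cscale (1 / (a * ?d)) (m3 0 (a * ?d) 0 0 0 0 0 0 0) \<in> S"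
      by (rule cmat.subspace_scale[OF S_subspace])
    then show "m3 0 1 0 0 0 0 0 0 0 \<in> S" using False Z by simp
    have "m3 0 0 0 0 0 (b * - ?d) 0 0 0 \<in> S"
      using comb[of 1 "- (t1 - t2)" "- (p * b - a * q)"] by (simp add: algebra_simps t3)
    then have "cscale (1 / (b * - ?d)) (m3 0 0 0 0 0 (b * - ?d) 0 0 0) \<in> S"
      by (rule cmat.subspace_scale[OF S_subspace])
    then show "m3 0 0 0 0 0 1 0 0 0 \<in> S" using False Z by simp
  qed
next
  case True
  then have t: "t2 = 0" "t3 = - t1" "t1 \<noteq> 0" using t3 nz by auto
  \<comment> \<open>The (1,2) entry that remains in \<open>T / t1\<close> after its (2,3) entry is
    cleared by the second generator.\<close>
  define w where "w = (p - q * a / b) / t1"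
  have mem: "m3 d x y 0 0 z 0 0 v \<in> S" if "d = c" "v = - c" "x = c * w + z * (a / b)" for c d v x y z
  proof -
    have "cscale (c / t1) (m3 t1 p 0 0 t2 q 0 0 t3) +
        cscale (z / b - c * q / (t1 * b)) (m3 0 a 0 0 0 b 0 0 0) +
        cscale y (m3 0 0 1 0 0 0 0 0 0) \<in> S"
      using E Z T by (intro cmat.subspace_add[OF S_subspace] cmat.subspace_scale[OF S_subspace])
    moreover have "c / t1 * p + (z / b - c * q / (t1 * b)) * a = x" "(c / t1) * q + (z / b - c * q / (t1 * b)) * b = z"
      using t Z by (simp_all add: that w_def field_simps)
    ultimately show ?thesis using t by (simp add: that)
  qed
  \<comment> \<open>The diagonal (a, 1, 1/b) carries E12 + E23 to a E12 + b E23, and the entry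
    \<open>- w\<close> produces the remaining E12 term of \<open>T\<close>.\<close>
  show ?thesis
  proof (rule ex_equivalent_listedI[OF S, of L3_two_ninths_1 "x1 + x2" x3 "h1 + h2"
        "m3 a (- w) 0 0 1 0 0 0 (1 / b)" "m3 (1 / a) (w / a) 0 0 1 0 0 0 b"])
    show "m3 a (- w) 0 0 1 0 0 0 (1 / b) ** (x1 + x2) ** m3 (1 / a) (w / a) 0 0 1 0 0 0 b \<in> S"
      using Z by (simp add: generators_m3) (rule mem[of _ 0], auto)
    show "m3 a (- w) 0 0 1 0 0 0 (1 / b) ** x3 ** m3 (1 / a) (w / a) 0 0 1 0 0 0 b \<in> S"
      using Z by (simp add: generators_m3) (rule mem[of _ 0], auto)
    show "m3 a (- w) 0 0 1 0 0 0 (1 / b) ** (h1 + h2) ** m3 (1 / a) (w / a) 0 0 1 0 0 0 b \<in> S"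
      using Z by (simp add: generators_m3) (rule mem[of _ 1], auto)
  qed (use Z in \<open>simp_all add: m3_one\<close>)
qed

lemma functional_zero:
  fixes f :: "cmat3 \<Rightarrow> complex"
  assumes "\<And>A B. f (A + B) = f A + f B" "\<And>k A. f (cscale k A) = k * f A"
  obtains A where "A \<in> S" "A \<noteq> 0" "f A = 0" "A $ i $ j = 0"
  by (rule common_zero_of_functionals[OF S_subspace S(2) assms, of "\<lambda>A. A $ i $ j"])
    (simp_all add: cscale_def)

text \<open>
  The roots take the distinct nonzero values \<open>4, 7, 11\<close> on \<open>diag(5, 1, - 6)\<close>, so \<open>S\<close> contains the
  diagonal part and the root components of each of its elements.
\<close>

lemma classify_with_torus_element:
  assumes upper: "\<And>X. X \<in> S \<Longrightarrow> upper_triangular3 X"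
    and D: "m3 5 0 0 0 1 0 0 0 (- 6) \<in> S" and T: "T \<in> S" "T$1$1 \<noteq> 5 * T$2$2"
  shows "\<exists>l. admissible l \<and> equivalent S (listed l)"
proof -
  have comb: "cscale x A + cscale y B \<in> S" if "A \<in> S" "B \<in> S" for x y A B
    using that by (intro cmat.subspace_add[OF S_subspace] cmat.subspace_scale[OF S_subspace])
  have trace: "X$1$1 + X$2$2 + X$3$3 = 0" if "X \<in> S" for X
    using that S(1) by (auto simp: lie_subalgebra_def A2_def trace_def sum_3)
  have parts: "m3 0 (X$1$2) 0 0 0 0 0 0 0 \<in> S" "m3 0 0 0 0 0 (X$2$3) 0 0 0 \<in> S"
    "m3 0 0 (X$1$3) 0 0 0 0 0 0 \<in> S" "m3 (X$1$1) 0 0 0 (X$2$2) 0 0 0 (X$3$3) \<in> S"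
    if X: "X \<in> S" for X
  proof -
    define p q r where "p = X$1$2" and "q = X$2$3" and "r = X$1$3"
    have X_eq: "X = m3 (X$1$1) p r 0 (X$2$2) q 0 0 (X$3$3)"
      using upper[OF X] by (simp add: vec_eq_iff forall_3 upper_triangular3_def p_def q_def r_def)
    have "lie_br (m3 5 0 0 0 1 0 0 0 (- 6)) X \<in> S" using D X by (rule S_lie_br)
    then have V1: "m3 0 (4 * p) (11 * r) 0 0 (7 * q) 0 0 0 \<in> S"
      by (subst (asm) X_eq) (simp add: lie_br_def algebra_simps)
    have V2: "m3 0 (16 * p) (121 * r) 0 0 (49 * q) 0 0 0 \<in> S"
      using S_lie_br[OF D V1] by (simp add: lie_br_def algebra_simps)
    \<comment> \<open>Vandermonde elimination: subtracting 4 times the first image removes E12, and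
      subtracting 7 times \<open>W1\<close> from \<open>W2\<close> later removes E23, leaving 308
      \<open>r\<close>.\<close>
    have W1: "m3 0 0 (77 * r) 0 0 (21 * q) 0 0 0 \<in> S"
      using comb[OF V2 V1, of 1 "- 4"] by simp
    have W2: "m3 0 0 (847 * r) 0 0 (147 * q) 0 0 0 \<in> S"
      using S_lie_br[OF D W1] by (simp add: lie_br_def algebra_simps)
    show r: "m3 0 0 (X$1$3) 0 0 0 0 0 0 \<in> S"
      using comb[OF W2 W1, of "1 / 308" "- (7 / 308)"] by (simp add: r_def)
    show q: "m3 0 0 0 0 0 (X$2$3) 0 0 0 \<in> S"
      using comb[OF W1 r, of "1 / 21" "- (77 / 21)"] by (simp add: r_def q_def)
    have "m3 0 (4 * p) (11 * r) 0 0 0 0 0 0 \<in> S"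
      using comb[OF V1 q, of 1 "- 7"] by (simp add: q_def)
    from comb[OF this r, of "1 / 4" "- (11 / 4)"]
    show p: "m3 0 (X$1$2) 0 0 0 0 0 0 0 \<in> S" by (simp add: p_def r_def)
    have "cscale 1 (cscale 1 X + cscale (- 1) (m3 0 p 0 0 0 0 0 0 0)) +
        cscale (- 1) (cscale 1 (m3 0 0 0 0 0 q 0 0 0) + cscale 1 (m3 0 0 r 0 0 0 0 0 0)) \<in> S"
      using p q r X unfolding p_def q_def r_def by (intro comb)
    then show "m3 (X$1$1) 0 0 0 (X$2$2) 0 0 0 (X$3$3) \<in> S"
      by (subst (asm) X_eq) simp
  qed
  have diagonal: "m3 a 0 0 0 b 0 0 0 c \<in> S" if "c = - a - b" for a b c
  proof -
    define t1 t2 where "t1 = T$1$1" and "t2 = T$2$2"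
    have T': "m3 t1 0 0 0 t2 0 0 0 (- t1 - t2) \<in> S"
    proof -
      have "T$3$3 = - t1 - t2" using trace[OF T(1)] unfolding t1_def t2_def by algebra
      then show ?thesis using parts(4)[OF T(1)] by (simp add: t1_def t2_def)
    qed
    define d where "d = t1 - 5 * t2"
    \<comment> \<open>Cramer's rule for combining the diagonals (5, 1) and (t1, t2) into (a,
      b).\<close>
    define x y where "x = (b * t1 - a * t2) / d" and "y = (a - 5 * b) / d"
    have d: "d \<noteq> 0" using T(2) by (simp add: d_def t1_def t2_def)
    have xy: "x * 5 + y * t1 = a" "x + y * t2 = b"
      using d by (simp_all add: x_def y_def divide_simps) (simp_all add: d_def algebra_simps)
    have "x * (- 6) + y * (- t1 - t2) = - (x * 5 + y * t1) - (x + y * t2)"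
      by (simp add: algebra_simps)
    also have "\<dots> = c" by (simp add: xy that)
    finally show ?thesis
      using comb[OF D T', of x y] xy by simp
  qed
  \<comment> \<open>The torus is only 2-dimensional, so some nonzero element has zero diagonal and
    contributes a root vector.\<close>
  obtain X where X: "X \<in> S" "X \<noteq> 0" "X$1$1 = 0" "X$2$2 = 0"
    by (rule functional_zero[of "\<lambda>A. A$1$1" 2 2]) (simp_all add: cscale_def)
  have "X$1$2 \<noteq> 0 \<or> X$2$3 \<noteq> 0 \<or> X$1$3 \<noteq> 0"
    using X trace[OF X(1)] upper[OF X(1)] by (auto simp: vec_eq_iff forall_3 upper_triangular3_def)
  then consider "m3 0 1 0 0 0 0 0 0 0 \<in> S" | "m3 0 0 0 0 0 1 0 0 0 \<in> S" | "m3 0 0 1 0 0 0 0 0 0 \<in> S"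
    using parts(1-3)[OF X(1), THEN cmat.subspace_scale[OF S_subspace, of _ "1 / X$1$2"]]
      parts(1-3)[OF X(1), THEN cmat.subspace_scale[OF S_subspace, of _ "1 / X$2$3"]]
      parts(1-3)[OF X(1), THEN cmat.subspace_scale[OF S_subspace, of _ "1 / X$1$3"]] by fastforce
  \<comment> \<open>A permutation of the coordinates carries the root vector to E12 and preserves
    the torus.\<close>
  then show ?thesis
  proof cases
    case 1
    then show ?thesis
      by (intro ex_equivalent_listedI[OF S, of L3_zero_1 x1 h1 h2 "mat 1" "mat 1"])
        (simp_all add: generators_m3 diagonal)
  next
    case 2
    then show ?thesis
      by (intro ex_equivalent_listedI[OF S, of L3_zero_1 x1 h1 h2 "m3 0 0 1 1 0 0 0 1 0" "m3 0 1 0 0 0 1 1 0 0"])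
        (simp_all add: generators_m3 m3_one diagonal)
  next
    case 3
    then show ?thesis
      by (intro ex_equivalent_listedI[OF S, of L3_zero_1 x1 h1 h2 "m3 1 0 0 0 0 1 0 1 0" "m3 1 0 0 0 0 1 0 1 0"])
        (simp_all add: generators_m3 m3_one diagonal)
  qed
qed

lemma classify_proportional_diagonals:
  assumes upper: "\<And>X. X \<in> S \<Longrightarrow> upper_triangular3 X"
    and diag: "\<And>X Y. X \<in> S \<Longrightarrow> Y \<in> S \<Longrightarrow> X$1$1 * Y$2$2 = X$2$2 * Y$1$1"
  shows "\<exists>l. admissible l \<and> equivalent S (listed l)"
proof -
  have trace: "X$3$3 = - X$1$1 - X$2$2" if "X \<in> S" for X
  proof -
    have "X$1$1 + X$2$2 + X$3$3 = 0"
      using that S(1) by (auto simp: lie_subalgebra_def A2_def trace_def sum_3)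
    then show ?thesis by algebra
  qed
  have X_eq: "X = m3 (X$1$1) (X$1$2) (X$1$3) 0 (X$2$2) (X$2$3) 0 0 (X$3$3)" if "X \<in> S" for X
    using upper[OF that] by (simp add: vec_eq_iff forall_3 upper_triangular3_def)
  \<comment> \<open>One diagonal entry controls the whole diagonal. Strict upper triangularity then
    costs a single functional, and a further entry can be made zero.\<close>
  have "\<exists>m. \<forall>X\<in>S. X$m$m = 0 \<longrightarrow> X$1$1 = 0 \<and> X$2$2 = 0"
  proof (cases "\<exists>T\<in>S. T$1$1 \<noteq> 0")
    case True
    then obtain T where "T \<in> S" "T$1$1 \<noteq> 0" by blast
    then have "X$2$2 = 0" if "X \<in> S" "X$1$1 = 0" for X
      using diag[of T X] that by simp
    then show ?thesis by (intro exI[of _ 1]) blast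
  qed (auto intro: exI[of _ 2])
  then obtain m where m: "\<And>X. X \<in> S \<Longrightarrow> X$m$m = 0 \<Longrightarrow> X$1$1 = 0 \<and> X$2$2 = 0" by blast
  have nilpotent: "\<exists>X\<in>S. X \<noteq> 0 \<and> X$i$j = 0 \<and> X = m3 0 (X$1$2) (X$1$3) 0 0 (X$2$3) 0 0 0" for i j
  proof -
    obtain X where X: "X \<in> S" "X \<noteq> 0" "X$m$m = 0" "X$i$j = 0"
      by (rule functional_zero[of "\<lambda>A. A$m$m" i j]) (simp_all add: cscale_def)
    have "X = m3 0 (X$1$2) (X$1$3) 0 0 (X$2$3) 0 0 0"
      using X_eq[OF X(1)] m[OF X(1,3)] trace[OF X(1)] by simp
    with X show ?thesis by blast
  qed
  obtain q r where X: "m3 0 0 r 0 0 q 0 0 0 \<in> S" "q \<noteq> 0 \<or> r \<noteq> 0"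
    using nilpotent[of 1 2] by (metis m3_eq_0_iff)
  obtain p r' where Y: "m3 0 p r' 0 0 0 0 0 0 \<in> S" "p \<noteq> 0 \<or> r' \<noteq> 0"
    using nilpotent[of 2 3] by (metis m3_eq_0_iff)
  \<comment> \<open>The bracket of the two elements is pq E13. If \<open>p\<close> or
    \<open>q\<close> is 0, one of them is itself a nonzero multiple of E13.\<close>
  have E: "m3 0 0 1 0 0 0 0 0 0 \<in> S"
  proof -
    have scale: "m3 0 0 1 0 0 0 0 0 0 \<in> S" if "m3 0 0 x 0 0 0 0 0 0 \<in> S" "x \<noteq> 0" for x
      using cmat.subspace_scale[OF S_subspace that(1), of "1 / x"] that(2) by simp
    have "m3 0 0 (p * q) 0 0 0 0 0 0 \<in> S"
      using S_lie_br[OF Y(1) X(1)] by (simp add: lie_br_def)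
    then show ?thesis
      using scale[of "p * q"] scale[of r] scale[of r'] X Y by (cases "p = 0"; cases "q = 0") auto
  qed
  obtain a b where Z: "m3 0 a 0 0 0 b 0 0 0 \<in> S" "a \<noteq> 0 \<or> b \<noteq> 0"
    using nilpotent[of 1 3] by (metis m3_eq_0_iff)
  have comb: "cscale x A + cscale y B \<in> S" if "A \<in> S" "B \<in> S" for x y A B
    using that by (intro cmat.subspace_add[OF S_subspace] cmat.subspace_scale[OF S_subspace])
  show ?thesis
  proof (cases "\<exists>T\<in>S. T$1$1 \<noteq> 0 \<or> T$2$2 \<noteq> 0")
    case True
    then obtain T where T: "T \<in> S" "T$1$1 \<noteq> 0 \<or> T$2$2 \<noteq> 0" by blast
    have "cscale 1 T + cscale (- T$1$3) (m3 0 0 1 0 0 0 0 0 0) \<in> S"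
      using T(1) E by (rule comb)
    then have T': "m3 (T$1$1) (T$1$2) 0 0 (T$2$2) (T$2$3) 0 0 (T$3$3) \<in> S"
      by (subst (asm) X_eq[OF T(1)]) simp
    consider "a \<noteq> 0" "b \<noteq> 0" | "a \<noteq> 0" "b = 0" | "a = 0" "b \<noteq> 0" using Z(2) by blast
    then show ?thesis
    proof cases
      case 1
      then show ?thesis by (intro classify_principal[OF E Z(1) _ _ T' trace[OF T(1)] T(2)])
    next
      case 2
      then have E12: "m3 0 1 0 0 0 0 0 0 0 \<in> S"
        using cmat.subspace_scale[OF S_subspace Z(1), of "1 / a"] by simp
      have "m3 (T$1$1) 0 0 0 (T$2$2) (T$2$3) 0 0 (T$3$3) \<in> S"
        using comb[OF T' E12, of 1 "- T$1$2"] by simp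
      then show ?thesis by (rule classify_row[OF E12 E _ trace[OF T(1)] T(2)])
    next
      case 3
      then have E23: "m3 0 0 0 0 0 1 0 0 0 \<in> S"
        using cmat.subspace_scale[OF S_subspace Z(1), of "1 / b"] by simp
      have "m3 (T$1$1) (T$1$2) 0 0 (T$2$2) 0 0 0 (T$3$3) \<in> S"
        using comb[OF T' E23, of 1 "- T$2$3"] by simp
      then show ?thesis by (rule classify_column[OF E23 E _ trace[OF T(1)] T(2)])
    qed
  next
    case False
    then have zero: "X = m3 0 (X$1$2) (X$1$3) 0 0 (X$2$3) 0 0 0" if "X \<in> S" for X
      using X_eq[OF that] trace[OF that] that by simp
    show ?thesis
    proof (rule classify_strictly_upper)
      obtain A where A: "A \<in> S" "A \<noteq> 0" "A$1$3 = 0" "A$2$3 = 0"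
        by (rule functional_zero[of "\<lambda>A. A$1$3" 2 3]) (simp_all add: cscale_def)
      have "A = m3 0 (A$1$2) 0 0 0 0 0 0 0" using zero[OF A(1)] A(3,4) by simp
      then have "m3 0 (A$1$2) 0 0 0 0 0 0 0 \<in> S" "A$1$2 \<noteq> 0" using A(1,2) by (metis, metis m3_zero)
      then show "m3 0 1 0 0 0 0 0 0 0 \<in> S"
        using cmat.subspace_scale[OF S_subspace, of "m3 0 (A$1$2) 0 0 0 0 0 0 0" "1 / A$1$2"] by simp
      obtain B where B: "B \<in> S" "B \<noteq> 0" "B$1$3 = 0" "B$1$2 = 0"
        by (rule functional_zero[of "\<lambda>A. A$1$3" 1 2]) (simp_all add: cscale_def)
      have "B = m3 0 0 0 0 0 (B$2$3) 0 0 0" using zero[OF B(1)] B(3,4) by simp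
      then have "m3 0 0 0 0 0 (B$2$3) 0 0 0 \<in> S" "B$2$3 \<noteq> 0" using B(1,2) by (metis, metis m3_zero)
      then show "m3 0 0 0 0 0 1 0 0 0 \<in> S"
        using cmat.subspace_scale[OF S_subspace, of "m3 0 0 0 0 0 (B$2$3) 0 0 0" "1 / B$2$3"] by simp
    qed
  qed
qed

end

text \<open>Two non-proportional diagonals span all traceless ones, so some element has diagonal (5,
  1, -6). Having distinct eigenvalues, it is diagonalized by a unipotent upper triangular matrix,
  which leaves all diagonals unchanged.\<close>

lemma classify_upper_triangular:
  assumes S: "lie_subalgebra S" "cmat.dim S = 3" and upper: "\<And>X. X \<in> S \<Longrightarrow> upper_triangular3 X"
  shows "\<exists>l. admissible l \<and> equivalent S (listed l)"
proof (cases "\<forall>X\<in>S. \<forall>Y\<in>S. X$1$1 * Y$2$2 = X$2$2 * Y$1$1")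
  case True
  then show ?thesis using classify_proportional_diagonals[OF S upper] by blast
next
  case False
  then obtain X Y where XY: "X \<in> S" "Y \<in> S" "X$1$1 * Y$2$2 \<noteq> X$2$2 * Y$1$1" by blast
  have trace: "A$1$1 + A$2$2 + A$3$3 = 0" if "A \<in> S" for A
    using that S(1) by (auto simp: lie_subalgebra_def A2_def trace_def sum_3)
  define d where "d = X$1$1 * Y$2$2 - X$2$2 * Y$1$1"
  have d: "d \<noteq> 0" using XY(3) by (simp add: d_def)
  define x y where "x = (5 * Y$2$2 - Y$1$1) / d" and "y = (X$1$1 - 5 * X$2$2) / d"
  define T where "T = cscale x X + cscale y Y"
  have T: "T \<in> S"
    unfolding T_def using XY S by (intro cmat.subspace_add cmat.subspace_scale) (auto simp: lie_subalgebra_def)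
  have diag: "T$1$1 = 5" "T$2$2 = 1"
    using d by (simp_all add: T_def cscale_def x_def y_def divide_simps) (simp_all add: d_def algebra_simps)
  then have "T$3$3 = - 6" using trace[OF T] by (simp add: add_eq_0_iff)
  define p q r where "p = T$1$2" and "q = T$2$3" and "r = T$1$3"
  have T_eq: "T = m3 5 p r 0 1 q 0 0 (- 6)"
    using upper[OF T] diag \<open>T$3$3 = - 6\<close>
    by (simp add: vec_eq_iff forall_3 upper_triangular3_def p_def q_def r_def)
  \<comment> \<open>Chosen so that the columns of \<open>?P\<close> are eigenvectors of
    \<open>T\<close> for 5, 1 and -6; the denominators are the root values 4, 7 and 11.\<close>
  define u v w where "u = - p / 4" and "v = - q / 7" and "w = - (p * v + r) / 11"
  let ?P = "m3 1 u w 0 1 v 0 0 1" and ?Q = "m3 1 (- u) (u * v - w) 0 1 (- v) 0 0 1"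
  have PQ: "?P ** ?Q = mat 1" "?Q ** ?P = mat 1" by (simp_all add: m3_one)
  let ?S = "(\<lambda>A. ?Q ** A ** ?P) ` S"
  have entries: "upper_triangular3 (?Q ** A ** ?P) \<and> (?Q ** A ** ?P)$1$1 = A$1$1 \<and>
      (?Q ** A ** ?P)$2$2 = A$2$2" if "A \<in> S" for A
  proof -
    have "A = m3 (A$1$1) (A$1$2) (A$1$3) 0 (A$2$2) (A$2$3) 0 0 (A$3$3)"
      using upper[OF that] by (simp add: vec_eq_iff forall_3 upper_triangular3_def)
    then obtain a b c e f g where "A = m3 a b c 0 e f 0 0 g" by blast
    then show ?thesis by (simp add: upper_triangular3_def)
  qed
  have "equivalent S ?S" unfolding equivalent_iff using PQ by blast
  moreover have "\<exists>l. admissible l \<and> equivalent ?S (listed l)"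
  proof -
    have "Y$1$1 \<noteq> 5 * Y$2$2 \<or> X$1$1 \<noteq> 5 * X$2$2" using XY(3) by auto
    then obtain T' where T': "T' \<in> S" "T'$1$1 \<noteq> 5 * T'$2$2" using XY by blast
    show ?thesis
    proof (rule classify_with_torus_element)
      show "lie_subalgebra ?S" by (rule lie_subalgebra_conj[OF S(1) PQ(1)])
      show "cmat.dim ?S = 3" using S(2) dim_conj[OF PQ(1)] by simp
      show "upper_triangular3 A" if "A \<in> ?S" for A using that entries by blast
      have "?Q ** T ** ?P = m3 5 0 0 0 1 0 0 0 (- 6)"
        unfolding T_eq by (simp add: u_def v_def w_def field_simps)
      then show "m3 5 0 0 0 1 0 0 0 (- 6) \<in> ?S" using T by (metis (no_types, lifting) image_eqI)
      show "?Q ** T' ** ?P \<in> ?S" using T' by blast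
      show "(?Q ** T' ** ?P)$1$1 \<noteq> 5 * (?Q ** T' ** ?P)$2$2" using entries[OF T'(1)] T'(2) by metis
    qed
  qed
  ultimately show ?thesis using equivalent_trans by blast
qed

lemma solvable_classification:
  assumes "lie_subalgebra S" "cmat.dim S = 3" "solvable S"
  shows "\<exists>l. admissible l \<and> equivalent S (listed l)"
  using solvable_triangularizable[OF assms] classify_upper_triangular equivalent_trans by metis

section \<open>Inequivalence\<close>

text \<open>Together with \<open>is_column\<close> this separates entries of equal type:
  \<open>L3_zero_1\<close> has both properties, \<open>L3_two_ninths_1\<close> has neither, and each
  family member has exactly one.\<close>

primrec is_row :: "label \<Rightarrow> bool" where
  "is_row L2_1 = True" | "is_row L2_2 = False" | "is_row L3_quarter_1 = True"
| "is_row L3_quarter_2 = False" | "is_row L3_two_ninths_1 = False" | "is_row L3_zero_1 = True"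
| "is_row (L3_family_1 \<alpha>) = True" | "is_row (L3_family_2 \<alpha>) = False" | "is_row L4_1 = True"
| "is_row L4_2 = False" | "is_row L5_1 = False"

primrec is_column :: "label \<Rightarrow> bool" where
  "is_column L2_1 = False" | "is_column L2_2 = True" | "is_column L3_quarter_1 = False"
| "is_column L3_quarter_2 = True" | "is_column L3_two_ninths_1 = False" | "is_column L3_zero_1 = True"
| "is_column (L3_family_1 \<alpha>) = False" | "is_column (L3_family_2 \<alpha>) = True" | "is_column L4_1 = False"
| "is_column L4_2 = True" | "is_column L5_1 = False"

lemma row_typeI:
  assumes "\<And>A i j. A \<in> nilpotents S \<Longrightarrow> i \<noteq> k \<Longrightarrow> A $ i $ j = 0"
  shows "row_type S"
  unfolding row_type_def
proof (rule exI[of _ "axis k 1"], rule ballI)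
  fix A assume "A \<in> nilpotents S"
  then have "A = outer (axis k 1) (A $ k)"
    using assms by (auto simp: vec_eq_iff outer_def axis_def)
  then show "\<exists>v. A = outer (axis k 1) v" by blast
qed

lemma column_typeI:
  assumes "\<And>A i j. A \<in> nilpotents S \<Longrightarrow> j \<noteq> k \<Longrightarrow> A $ i $ j = 0"
  shows "column_type S"
  unfolding column_type_def
proof (rule exI[of _ "axis k 1"], rule ballI)
  fix A assume "A \<in> nilpotents S"
  then have "A = outer (\<chi> i. A $ i $ k) (axis k 1)"
    using assms by (auto simp: vec_eq_iff outer_def axis_def)
  then show "\<exists>u. A = outer u (axis k 1)" by blast
qed

lemma row_type_listed:
  assumes l: "admissible l" shows "row_type (listed l) \<longleftrightarrow> is_row l"
proof -
  obtain X Y Z where W: "listed_generators l = (X, Y, Z)" by (metis prod_cases3)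
  show ?thesis
  proof (cases "is_row l")
    case True
    have "A $ i $ j = 0" if A: "A \<in> nilpotents (listed l)" and ij: "i \<noteq> 1" for A i j
    proof -
      obtain a b c where "A = cscale a X + cscale b Y + cscale c Z" "A ** A ** A = 0"
        using A unfolding nilpotents_listed[OF l W] by blast
      then show ?thesis
        using W True l ij exhaust_3[of i] exhaust_3[of j] by (cases l) (auto simp: generators_m3)
    qed
    then show ?thesis using True row_typeI by blast
  next
    case False
    have "X \<in> nilpotents (listed l)" "Y \<in> nilpotents (listed l)"
      using nilpotents_listed[OF l W, of X] nilpotents_listed[OF l W, of Y] False W
      by (cases l; force simp: generators_m3)+
    moreover have "\<not> (X = outer u v \<and> Y = outer u w)" for u v w
    proof
      assume "X = outer u v \<and> Y = outer u w"
      then have "X$i$j * Y$k$n = X$k$j * Y$i$n" "X$i$j * X$k$n = X$k$j * X$i$n" for i j k n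
        by (simp_all add: outer_def)
      \<comment> \<open>A minor that would have to vanish, for each shape of generators:
        \<open>x1, y2\<close>, then \<open>y1, y3\<close>, then \<open>x1, x2\<close>, and finally
        \<open>x1 + x2\<close>, which has rank two by itself.\<close>
      from this(1)[of 1 2 3 2] this(1)[of 2 1 3 1] this(1)[of 1 2 2 3] this(2)[of 1 2 2 3]
      show False using False W by (cases l) (auto simp: generators_m3)
    qed
    ultimately show ?thesis using False unfolding row_type_def by blast
  qed
qed

lemma column_type_listed:
  assumes l: "admissible l" shows "column_type (listed l) \<longleftrightarrow> is_column l"
proof -
  obtain X Y Z where W: "listed_generators l = (X, Y, Z)" by (metis prod_cases3)
  show ?thesis
  proof (cases "is_column l")
    case True
    \<comment> \<open>Only \<open>L3_quarter_2\<close> is generated by \<open>y1\<close> and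
      \<open>y3\<close>, which sit in the first column.\<close>
    have "A $ i $ j = 0" if A: "A \<in> nilpotents (listed l)" and ij: "j \<noteq> (if l = L3_quarter_2 then 1 else 2)" for A i j
    proof -
      obtain a b c where "A = cscale a X + cscale b Y + cscale c Z" "A ** A ** A = 0"
        using A unfolding nilpotents_listed[OF l W] by blast
      then show ?thesis
        using W True l ij exhaust_3[of i] exhaust_3[of j] by (cases l) (auto simp: generators_m3)
    qed
    then show ?thesis using True column_typeI by blast
  next
    case False
    have "X \<in> nilpotents (listed l)" "Y \<in> nilpotents (listed l)"
      using nilpotents_listed[OF l W, of X] nilpotents_listed[OF l W, of Y] False W
      by (cases l; force simp: generators_m3)+
    moreover have "\<not> (X = outer u v \<and> Y = outer w v)" for u v w
    proof
      assume "X = outer u v \<and> Y = outer w v"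
      then have "X$i$j * Y$k$n = X$i$n * Y$k$j" "X$i$j * X$k$n = X$i$n * X$k$j" for i j k n
        by (simp_all add: outer_def)
      from this(1)[of 1 2 1 3] this(1)[of 1 2 2 3] this(2)[of 1 2 2 3]
      show False using False W by (cases l) (auto simp: generators_m3)
    qed
    ultimately show ?thesis using False unfolding column_type_def by blast
  qed
qed

text \<open>Since (2\<alpha> - 1)(\<alpha> - 2) = 2(\<alpha> - 1)^2 - \<alpha>, the parameter
  depends only on \<alpha>/(\<alpha> - 1)^2, which is invariant under inversion of \<alpha>.\<close>

lemma family_parameter_eq:
  fixes \<alpha> \<beta> :: complex
  assumes "(2 * \<alpha> - 1) * (\<alpha> - 2) / (9 * (\<alpha> - 1)\<^sup>2) = (2 * \<beta> - 1) * (\<beta> - 2) / (9 * (\<beta> - 1)\<^sup>2)"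
    and "\<alpha> \<noteq> 1" "\<beta> \<noteq> 1"
  shows "\<alpha> = \<beta> \<or> \<alpha> * \<beta> = 1"
proof -
  have "(2 * \<alpha> - 1) * (\<alpha> - 2) * (\<beta> - 1)\<^sup>2 = (2 * \<beta> - 1) * (\<beta> - 2) * (\<alpha> - 1)\<^sup>2"
    using assms by (simp add: divide_simps mult.assoc)
  then have "(\<alpha> - \<beta>) * (\<alpha> * \<beta> - 1) = 0" by algebra
  then show ?thesis by simp
qed

text \<open>This separates the families from \<open>L3_quarter_1\<close> and
  \<open>L3_quarter_2\<close>, whose row and column behavior they share. Clearing denominators
  leaves (\<alpha> + 1)^2 = 0.\<close>

lemma family_parameter_neq_quarter:
  fixes \<alpha> :: complex
  assumes "\<alpha> \<noteq> 1" "\<alpha> \<noteq> -1"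
  shows "(2 * \<alpha> - 1) * (\<alpha> - 2) / (9 * (\<alpha> - 1)\<^sup>2) \<noteq> 1 / 4"
proof
  assume "(2 * \<alpha> - 1) * (\<alpha> - 2) / (9 * (\<alpha> - 1)\<^sup>2) = 1 / 4"
  then have "4 * ((2 * \<alpha> - 1) * (\<alpha> - 2)) = 9 * (\<alpha> - 1)\<^sup>2"
    using assms by (simp add: divide_simps mult_ac)
  then have "(\<alpha> + 1) * (\<alpha> + 1) = 0" by algebra
  then show False using assms by (simp add: add_eq_0_iff2)
qed

text \<open>With \<alpha>\<beta> = 1, exchanging coordinates 2 and 3 in the first family, or 1 and 3
  in the second, carries the torus generator for \<beta> to -\<beta> times the one for \<alpha> and
  exchanges the two root lines.\<close>

lemma equivalent_listed_swap:
  assumes "\<alpha> * \<beta> = 1" "\<alpha> \<noteq> 1" "\<alpha> \<noteq> -1" "\<beta> \<noteq> 1" "\<beta> \<noteq> -1"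
  shows "equivalent (listed (L3_family_1 \<alpha>)) (listed (L3_family_1 \<beta>))"
    and "equivalent (listed (L3_family_2 \<alpha>)) (listed (L3_family_2 \<beta>))"
proof -
  have adm: "admissible (L3_family_1 \<alpha>)" "admissible (L3_family_1 \<beta>)"
    "admissible (L3_family_2 \<alpha>)" "admissible (L3_family_2 \<beta>)"
    using assms by simp_all
  let ?P = "m3 1 0 0 0 0 1 0 1 0" and ?P' = "m3 0 0 1 0 1 0 1 0 0"
  have span1: "listed (L3_family_1 \<alpha>) = cmat.span {x1, x3, cscale (\<alpha> - 1) h1 + cscale \<alpha> h2}"
    by (rule listed_span[OF adm(1)]) simp
  have span2: "listed (L3_family_2 \<alpha>) = cmat.span {x1, y2, h1 + cscale \<alpha> h2}"
    by (rule listed_span[OF adm(3)]) simp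
  show "equivalent (listed (L3_family_1 \<alpha>)) (listed (L3_family_1 \<beta>))"
  proof (rule equivalent_listedI[OF _ _ adm(2), of _ x1 x3 "cscale (\<beta> - 1) h1 + cscale \<beta> h2" ?P ?P])
    have "?P ** x1 ** ?P = cscale 0 x1 + cscale (-1) x3 + cscale 0 (cscale (\<alpha> - 1) h1 + cscale \<alpha> h2)"
      "?P ** x3 ** ?P = cscale (-1) x1 + cscale 0 x3 + cscale 0 (cscale (\<alpha> - 1) h1 + cscale \<alpha> h2)"
      "?P ** (cscale (\<beta> - 1) h1 + cscale \<beta> h2) ** ?P =
        cscale 0 x1 + cscale 0 x3 + cscale (- \<beta>) (cscale (\<alpha> - 1) h1 + cscale \<alpha> h2)"
      using assms(1) by (simp_all add: generators_m3 algebra_simps)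
    then show "?P ** x1 ** ?P \<in> listed (L3_family_1 \<alpha>)" "?P ** x3 ** ?P \<in> listed (L3_family_1 \<alpha>)"
      "?P ** (cscale (\<beta> - 1) h1 + cscale \<beta> h2) ** ?P \<in> listed (L3_family_1 \<alpha>)"
      unfolding span1 span_triple_iff by blast+
  qed (use listed_correct[OF adm(1)] in \<open>simp_all add: m3_one\<close>)
  show "equivalent (listed (L3_family_2 \<alpha>)) (listed (L3_family_2 \<beta>))"
  proof (rule equivalent_listedI[OF _ _ adm(4), of _ x1 y2 "h1 + cscale \<beta> h2" ?P' ?P'])
    have "?P' ** x1 ** ?P' = cscale 0 x1 + cscale 1 y2 + cscale 0 (h1 + cscale \<alpha> h2)"
      "?P' ** y2 ** ?P' = cscale 1 x1 + cscale 0 y2 + cscale 0 (h1 + cscale \<alpha> h2)"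
      "?P' ** (h1 + cscale \<beta> h2) ** ?P' = cscale 0 x1 + cscale 0 y2 + cscale (- \<beta>) (h1 + cscale \<alpha> h2)"
      using assms(1) by (simp_all add: generators_m3 algebra_simps)
    then show "?P' ** x1 ** ?P' \<in> listed (L3_family_2 \<alpha>)" "?P' ** y2 ** ?P' \<in> listed (L3_family_2 \<alpha>)"
      "?P' ** (h1 + cscale \<beta> h2) ** ?P' \<in> listed (L3_family_2 \<alpha>)"
      unfolding span2 span_triple_iff by blast+
  qed (use listed_correct[OF adm(3)] in \<open>simp_all add: m3_one\<close>)
qed

lemma equivalent_listed_invariants:
  assumes "admissible l" "admissible m" "equivalent (listed l) (listed m)"
  shows "subscript l = subscript m" "is_row l \<longleftrightarrow> is_row m" "is_column l \<longleftrightarrow> is_column m"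
proof -
  have "has_type (listed m) (subscript l)" "has_type (listed m) (subscript m)"
    using listed_correct[OF assms(1)] listed_correct[OF assms(2)] has_type_equivalent[OF _ assms(3)]
    by blast+
  then show "subscript l = subscript m" by (rule has_type_unique)
  show "is_row l \<longleftrightarrow> is_row m" "is_column l \<longleftrightarrow> is_column m"
    using row_type_equivalent column_type_equivalent assms equivalent_sym
    by (metis row_type_listed, metis column_type_listed)
qed

theorem theorem6p5:
  shows
    "(\<forall>l. admissible l \<longrightarrow>
        lie_subalgebra (listed l) \<and> cmat.dim (listed l) = 3 \<and> solvable (listed l) \<and>
        has_type (listed l) (subscript l)) \<and>
     (\<forall>S. lie_subalgebra S \<and> cmat.dim S = 3 \<and> solvable S \<longrightarrow>
        (\<exists>l. admissible l \<and> equivalent S (listed l))) \<and>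
     (\<forall>l m. admissible l \<and> admissible m \<longrightarrow>
        (equivalent (listed l) (listed m) \<longleftrightarrow>
           l = m \<or>
           (\<exists>\<alpha> \<beta>. \<alpha> * \<beta> = 1 \<and>
              (l = L3_family_1 \<alpha> \<and> m = L3_family_1 \<beta> \<or>
               l = L3_family_2 \<alpha> \<and> m = L3_family_2 \<beta>))))"
proof (intro conjI allI impI)
  fix l m assume lm: "admissible l \<and> admissible m"
  show "equivalent (listed l) (listed m) \<longleftrightarrow>
      l = m \<or> (\<exists>\<alpha> \<beta>. \<alpha> * \<beta> = 1 \<and>
        (l = L3_family_1 \<alpha> \<and> m = L3_family_1 \<beta> \<or> l = L3_family_2 \<alpha> \<and> m = L3_family_2 \<beta>))"
    (is "_ \<longleftrightarrow> ?R")
  proof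
    assume eq: "equivalent (listed l) (listed m)"
    note inv = equivalent_listed_invariants[OF _ _ eq]
    \<comment> \<open>The three invariants leave, apart from equal labels, only pairs within one
      family, where equal subscripts force equal or inverse parameters.\<close>
    show ?R
      using inv lm family_parameter_eq family_parameter_neq_quarter
      by (cases l; cases m) (auto simp: eq_commute[of "1 / 4 :: complex"])
  next
    assume ?R
    then show "equivalent (listed l) (listed m)"
      using lm equivalent_listed_swap equivalent_refl by auto
  qed
next
  fix S assume "lie_subalgebra S \<and> cmat.dim S = 3 \<and> solvable S"
  then show "\<exists>l. admissible l \<and> equivalent S (listed l)"
    using solvable_classification by blast
qed (use listed_correct in auto)

end
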